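(* Let $n$ be a nonnegative integer with $n \equiv 1, 2 \pmod 4$ (that is, $n\equiv 1$ or $n\equiv 2 \pmod 4$). Then $$s(25n) - 5 s(n) = 4\,(2,2,2,-1,1,1)(n).$$
   Context: For integers $a,b,c,d,e,f$, $(a,b,c,d,e,f)(n)$ denotes the number of representations of $n$ by the ternary quadratic form $ax^2+by^2+cz^2+dyz+ezx+fxy$, i.e. the number of triples $(x,y,z)\in\mathbb{Z}^3$ with $ax^2+by^2+cz^2+dyz+ezx+fxy=n$. In particular $(2,2,2,-1,1,1)(n)$ counts $(x,y,z)\in\mathbb{Z}^3$ with $2x^2+2y^2+2z^2-yz+zx+xy=n$. $s(n)$ denotes the number of triples $(x,y,z)\in\mathbb{Z}^3$ with $x^2+y^2+z^2=n$. *)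

theory Defs
  imports Main
begin

text \<open>
  \<open>rep_count a b c d e f n\<close> is \<open>(a,b,c,d,e,f)(n)\<close>. The coefficients \<open>d\<close>, \<open>e\<close>, \<open>f\<close> belong to
  \<open>yz\<close>, \<open>zx\<close>, \<open>xy\<close>, in this order. Since \<^const>\<open>card\<close> of an infinite set is \<open>0\<close>, the value is
  meaningful only if the set is finite, as it is for every positive definite form;
  for the two forms of interest this is proved below.
\<close>

definition rep_count :: "int \<Rightarrow> int \<Rightarrow> int \<Rightarrow> int \<Rightarrow> int \<Rightarrow> int \<Rightarrow> nat \<Rightarrow> nat" where
  "rep_count a b c d e f n =
     card {(x :: int, y :: int, z :: int).
             a * x\<^sup>2 + b * y\<^sup>2 + c * z\<^sup>2 + d * y * z + e * z * x + f * x * y = int n}"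

definition s :: "nat \<Rightarrow> nat" where
  "s n = card {(x :: int, y :: int, z :: int). x\<^sup>2 + y\<^sup>2 + z\<^sup>2 = int n}"

lemma abs_le_of_square_le:
  fixes x :: int
  assumes "x\<^sup>2 \<le> int n"
  shows "x \<in> {- int n..int n}"
proof -
  have "\<bar>x\<bar> \<le> x\<^sup>2"
    using self_le_power[of "\<bar>x\<bar>" 2] by (cases "x = 0") auto
  with assms show ?thesis by auto
qed

lemma finite_sum_three_squares_reps:
  "finite {(x :: int, y :: int, z :: int). x\<^sup>2 + y\<^sup>2 + z\<^sup>2 = int n}"
proof (rule finite_subset)
  show "{(x :: int, y :: int, z :: int). x\<^sup>2 + y\<^sup>2 + z\<^sup>2 = int n}
          \<subseteq> {- int n..int n} \<times> {- int n..int n} \<times> {- int n..int n}"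
  proof clarify
    fix x y z :: int
    assume "x\<^sup>2 + y\<^sup>2 + z\<^sup>2 = int n"
    then have "x\<^sup>2 \<le> int n" "y\<^sup>2 \<le> int n" "z\<^sup>2 \<le> int n"
      using zero_le_power2[of x] zero_le_power2[of y] zero_le_power2[of z] by linarith+
    then show "x \<in> {- int n..int n} \<and> (y, z) \<in> {- int n..int n} \<times> {- int n..int n}"
      using abs_le_of_square_le by blast
  qed
qed simp

lemma finite_reps_2_2_2_m1_1_1:
  "finite {(x :: int, y :: int, z :: int).
             2 * x\<^sup>2 + 2 * y\<^sup>2 + 2 * z\<^sup>2 + (-1) * y * z + 1 * z * x + 1 * x * y = int n}"
    (is "finite ?R")
proof (rule finite_subset)
  show "?R \<subseteq> {- int n..int n} \<times> {- int n..int n} \<times> {- int n..int n}"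
  proof clarify
    fix x y z :: int
    assume *: "2 * x\<^sup>2 + 2 * y\<^sup>2 + 2 * z\<^sup>2 + (-1) * y * z + 1 * z * x + 1 * x * y = int n"
    have "2 * (2 * x\<^sup>2 + 2 * y\<^sup>2 + 2 * z\<^sup>2 + (-1) * y * z + 1 * z * x + 1 * x * y)
            = (x + y)\<^sup>2 + (x + z)\<^sup>2 + (y - z)\<^sup>2 + 2 * x\<^sup>2 + 2 * y\<^sup>2 + 2 * z\<^sup>2"
      by (simp add: power2_eq_square algebra_simps)
    then have "x\<^sup>2 \<le> int n" "y\<^sup>2 \<le> int n" "z\<^sup>2 \<le> int n"
      unfolding *
      using zero_le_power2[of x] zero_le_power2[of y] zero_le_power2[of z]
        zero_le_power2[of "x + y"] zero_le_power2[of "x + z"] zero_le_power2[of "y - z"]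
      by linarith+
    then show "x \<in> {- int n..int n} \<and> (y, z) \<in> {- int n..int n} \<times> {- int n..int n}"
      using abs_le_of_square_le by blast
  qed
qed simp

end

theory Submission
  imports Defs "HOL-Computational_Algebra.Formal_Power_Series"
begin

text \<open>
  Let \<open>r(n)\<close> count the representations of \<open>n\<close> by \<open>x\<^sup>2 + 5y\<^sup>2 + 5z\<^sup>2\<close>. Multiplication by
  \<open>2 \<plusminus> i\<close> in the Gaussian integers relates the representations of \<open>m\<close> and \<open>5m\<close> as a sum of two
  squares and yields \<open>s(25n) = 7 s(n) - 6 r(n)\<close>, so it remains to show that
  \<open>s(n) - 3 r(n) = 2 (2,2,2,-1,1,1)(n)\<close> for \<open>n \<equiv> 1, 2 (mod 4)\<close>. The form \<open>(2,2,2,-1,1,1)\<close> is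
  symmetric in \<open>-x, y, z\<close>, and for these \<open>n\<close> exactly one of the sums of two of these three numbers is
  even; this turns the claim into one identity between products of theta constants for each of the
  two residue classes. Since \<open>(2,2,2,-1,1,1)\<close> is not rationally equivalent to \<open>x\<^sup>2 + y\<^sup>2 + z\<^sup>2\<close>, a
  change of variables cannot prove these identities. They follow because the squares and products
  of the theta constants involved are quadratic polynomials in the six series \<open>\<Sum>q\<^bsup>m\<^sup>2/10\<^esup>\<close>, \<open>m \<equiv> k (mod 10)\<close>,
  \<open>0 \<le> k \<le> 5\<close>, by changes of variables in rank two, together with
  \<open>\<phi>(q)\<^sup>2 = \<phi>(q\<^sup>5)\<^sup>2 + 4q f(q,q\<^sup>9) f(q\<^sup>3,q\<^sup>7)\<close> and its analogue for \<open>\<psi>\<close>, which come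
  from multiplication by \<open>2 + i\<close>. Eliminating the six series gives the squares of both sides, and
  the leading terms decide the signs.
\<close>

unbundle fps_syntax

subsection \<open>Weighted generating functions\<close>

definition gf :: "'a set \<Rightarrow> ('a \<Rightarrow> int) \<Rightarrow> ('a \<Rightarrow> int) \<Rightarrow> int fps" where
  "gf A f w = Abs_fps (\<lambda>n. \<Sum>x\<in>{x \<in> A. f x = int n}. w x)"

text \<open>Under these conditions \<open>gf\<close> is the formal sum of \<open>w x\<close> times q
  to the power \<open>f x\<close> over \<open>A\<close>: otherwise \<open>gf\<close> drops negative
  exponents and counts an infinite fibre as 0.\<close>

definition proper :: "'a set \<Rightarrow> ('a \<Rightarrow> int) \<Rightarrow> bool" where
  "proper A f \<longleftrightarrow> (\<forall>x\<in>A. 0 \<le> f x) \<and> (\<forall>n. finite {x \<in> A. f x \<le> n})"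

lemma proper_finite: "proper A f \<Longrightarrow> finite {x \<in> A. f x = n}"
  unfolding proper_def by (rule finite_subset[of _ "{x \<in> A. f x \<le> n}"]) auto

lemma proper_subset: "proper B f \<Longrightarrow> A \<subseteq> B \<Longrightarrow> proper A f"
  unfolding proper_def by (auto intro: finite_subset[of "{x \<in> A. f x \<le> _}" "{x \<in> B. f x \<le> _}"])

lemma proper_times:
  assumes "proper A f" "proper B g"
  shows "proper (A \<times> B) (\<lambda>(x, y). f x + g y)"
  unfolding proper_def
proof (intro conjI allI ballI)
  fix n
  have "{x \<in> A \<times> B. (\<lambda>(x, y). f x + g y) x \<le> n} \<subseteq> {x \<in> A. f x \<le> n} \<times> {x \<in> B. g x \<le> n}"
  proof
    fix p assume p: "p \<in> {x \<in> A \<times> B. (\<lambda>(x, y). f x + g y) x \<le> n}"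
    then have "0 \<le> f (fst p)" "0 \<le> g (snd p)" using assms by (auto simp: proper_def)
    with p show "p \<in> {x \<in> A. f x \<le> n} \<times> {x \<in> B. g x \<le> n}" by auto
  qed
  then show "finite {x \<in> A \<times> B. (\<lambda>(x, y). f x + g y) x \<le> n}"
    using assms unfolding proper_def by (meson finite_SigmaI finite_subset)
qed (use assms in \<open>auto simp: proper_def\<close>)

lemma gf_mult:
  assumes "proper A f" "proper B g"
  shows "gf A f v * gf B g w = gf (A \<times> B) (\<lambda>(x, y). f x + g y) (\<lambda>(x, y). v x * w y)"
proof (rule fps_ext)
  fix n
  let ?F = "\<lambda>i. {x \<in> A. f x = int i} \<times> {x \<in> B. g x = int (n - i)}"
  have "(gf A f v * gf B g w) $ n = (\<Sum>i=0..n. \<Sum>p\<in>?F i. (\<lambda>(x, y). v x * w y) p)"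
    by (simp add: fps_mult_nth gf_def sum_product sum.cartesian_product)
  also have "\<dots> = (\<Sum>p\<in>(\<Union>i\<in>{0..n}. ?F i). (\<lambda>(x, y). v x * w y) p)"
    by (rule sum.UNION_disjoint[symmetric]) (use assms in \<open>auto intro!: proper_finite\<close>)
  also have "(\<Union>i\<in>{0..n}. ?F i) = {p \<in> A \<times> B. (\<lambda>(x, y). f x + g y) p = int n}"
  proof (intro subset_antisym subsetI)
    fix p assume "p \<in> {p \<in> A \<times> B. (\<lambda>(x, y). f x + g y) p = int n}"
    then obtain x y where p: "p = (x, y)" "x \<in> A" "y \<in> B" "f x + g y = int n" by auto
    moreover have "0 \<le> f x" "0 \<le> g y" using p assms by (auto simp: proper_def)
    ultimately have "nat (f x) \<in> {0..n}" "p \<in> ?F (nat (f x))" by auto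
    then show "p \<in> (\<Union>i\<in>{0..n}. ?F i)" by blast
  qed (auto simp: of_nat_diff)
  finally show "(gf A f v * gf B g w) $ n =
      gf (A \<times> B) (\<lambda>(x, y). f x + g y) (\<lambda>(x, y). v x * w y) $ n"
    by (simp add: gf_def)
qed

lemma gf_UN:
  assumes "finite J" "\<And>j. j \<in> J \<Longrightarrow> proper (A j) f"
    and "\<And>i j. i \<in> J \<Longrightarrow> j \<in> J \<Longrightarrow> i \<noteq> j \<Longrightarrow> A i \<inter> A j = {}"
  shows "gf (\<Union>j\<in>J. A j) f w = (\<Sum>j\<in>J. gf (A j) f w)"
proof (rule fps_ext)
  fix n
  have *: "{x \<in> (\<Union>j\<in>J. A j). f x = int n} = (\<Union>j\<in>J. {x \<in> A j. f x = int n})" by auto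
  show "gf (\<Union>j\<in>J. A j) f w $ n = (\<Sum>j\<in>J. gf (A j) f w) $ n"
    unfolding gf_def fps_nth_Abs_fps fps_sum_nth *
    by (rule sum.UNION_disjoint) (use assms in \<open>auto intro: proper_finite\<close>)
qed

lemma gf_Un:
  assumes "proper A f" "proper B f" "A \<inter> B = {}"
  shows "gf (A \<union> B) f w = gf A f w + gf B f w"
proof (rule fps_ext)
  fix n
  have *: "{x \<in> A \<union> B. f x = int n} = {x \<in> A. f x = int n} \<union> {x \<in> B. f x = int n}" by auto
  show "gf (A \<union> B) f w $ n = (gf A f w + gf B f w) $ n"
    unfolding gf_def fps_nth_Abs_fps fps_add_nth *
    by (rule sum.union_disjoint) (use assms in \<open>auto intro: proper_finite\<close>)
qed

lemma gf_reindex: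
  assumes "\<And>x. x \<in> A \<Longrightarrow> j x \<in> B \<and> i (j x) = x \<and> g (j x) = f x \<and> w (j x) = v x"
    and "\<And>y. y \<in> B \<Longrightarrow> i y \<in> A \<and> j (i y) = y"
  shows "gf A f v = gf B g w"
proof (rule fps_ext)
  fix n
  show "gf A f v $ n = gf B g w $ n"
    unfolding gf_def fps_nth_Abs_fps
  proof (rule sum.reindex_bij_witness[where i = i and j = j])
    fix b assume b: "b \<in> {x \<in> B. g x = int n}"
    then have "i b \<in> A" "j (i b) = b" using assms(2) by auto
    then show "i b \<in> {x \<in> A. f x = int n}" using b assms(1)[of "i b"] by auto
  qed (use assms in auto)
qed

lemma gf_nth_card: "gf A f (\<lambda>_. 1) $ n = int (card {x \<in> A. f x = int n})"
  by (simp add: gf_def)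

subsection \<open>Theta series\<close>

text \<open>\<open>k\<close> has to be the least nonnegative residue modulo a positive
  \<open>N\<close>; any other \<open>k\<close> gives the zero series, hence the explicit
  \<open>mod\<close> in the product rules below. \<open>N = 1\<close>, \<open>k = 0\<close> sums
  over all integers.\<close>

definition th :: "(int \<Rightarrow> int) \<Rightarrow> int \<Rightarrow> int \<Rightarrow> int \<Rightarrow> int fps" where
  "th v c N k = gf {m. m mod N = k} (\<lambda>m. c * m\<^sup>2) v"

abbreviation one :: "int \<Rightarrow> int" where "one \<equiv> \<lambda>_. 1"

text \<open>Being multiplicative, the sign weight obeys the same product rule as the weight
  1.\<close>

definition alt :: "int \<Rightarrow> int" where "alt m = (if even m then 1 else -1)"

lemma proper_square:
  assumes "c > 0"
  shows "proper A (\<lambda>m::int. c * m\<^sup>2)"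
proof (rule proper_subset[of UNIV])
  show "proper UNIV (\<lambda>m::int. c * m\<^sup>2)"
    unfolding proper_def
  proof (intro conjI allI ballI)
    fix n :: int
    have "{x \<in> UNIV. c * x\<^sup>2 \<le> n} \<subseteq> {- int (nat n)..int (nat n)}"
    proof
      fix x :: int assume "x \<in> {x \<in> UNIV. c * x\<^sup>2 \<le> n}"
      then have *: "c * x\<^sup>2 \<le> n" by simp
      have "1 * x\<^sup>2 \<le> c * x\<^sup>2" using assms by (intro mult_right_mono) auto
      with * have "x\<^sup>2 \<le> n" by simp
      also have "n \<le> int (nat n)" by simp
      finally show "x \<in> {- int (nat n)..int (nat n)}" by (rule abs_le_of_square_le)
    qed
    then show "finite {x \<in> UNIV. c * x\<^sup>2 \<le> n}" by (rule finite_subset) simp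
  qed (use assms in auto)
qed simp

lemma th_mult:
  assumes "c > 0" "c' > 0"
  shows "th v c N k * th w c' N' k' =
    gf ({m. m mod N = k} \<times> {m. m mod N' = k'}) (\<lambda>(x, y). c * x\<^sup>2 + c' * y\<^sup>2) (\<lambda>(x, y). v x * w y)"
  unfolding th_def by (rule gf_mult) (use assms in \<open>auto intro: proper_square\<close>)

lemma proper_square2:
  assumes "c > 0" "c' > 0"
  shows "proper A (\<lambda>(x, y). c * x\<^sup>2 + c' * y\<^sup>2)"
  by (rule proper_subset[OF proper_times[OF proper_square proper_square]]) (use assms in auto)

lemma th3_nth:
  assumes "c1 > 0" "c2 > 0" "c3 > 0"
  shows "(th one c1 N1 k1 * th one c2 N2 k2 * th one c3 N3 k3) $ n =
    int (card {(x, y, z). x mod N1 = k1 \<and> y mod N2 = k2 \<and> z mod N3 = k3 \<and>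
      c1 * x\<^sup>2 + c2 * y\<^sup>2 + c3 * z\<^sup>2 = int n})"
proof -
  let ?A = "{m. m mod N1 = k1} \<times> {m. m mod N2 = k2}" and ?B = "{m. m mod N3 = k3}"
  let ?f = "\<lambda>((x, y), z). c1 * x\<^sup>2 + c2 * y\<^sup>2 + c3 * z\<^sup>2"
  have "th one c1 N1 k1 * th one c2 N2 k2 * th one c3 N3 k3 = gf (?A \<times> ?B) ?f (\<lambda>_. 1)"
    unfolding th_mult[OF assms(1,2)] unfolding th_def
      gf_mult[OF proper_square2[OF assms(1,2)] proper_square[OF assms(3)]]
    by (simp add: split_def)
  then have "(th one c1 N1 k1 * th one c2 N2 k2 * th one c3 N3 k3) $ n =
      int (card {p \<in> ?A \<times> ?B. ?f p = int n})"
    by (simp only: gf_nth_card)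
  also have "card {p \<in> ?A \<times> ?B. ?f p = int n} = card {(x, y, z). x mod N1 = k1 \<and> y mod N2 = k2 \<and> z mod N3 = k3 \<and>
      c1 * x\<^sup>2 + c2 * y\<^sup>2 + c3 * z\<^sup>2 = int n}"
    by (rule bij_betw_same_card[OF bij_betw_byWitness
          [where f = "\<lambda>((x, y), z). (x, y, z)" and f' = "\<lambda>(x, y, z). ((x, y), z)"]]) auto
  finally show ?thesis .
qed

lemma th_uminus:
  assumes "N > 0" "0 < k" "k < N"
  shows "th one c N (N - k) = th one c N k"
  unfolding th_def
proof (rule gf_reindex[where i = uminus and j = uminus], goal_cases)
  case (1 x)
  then have "x mod N = N - k" by simp
  then have "(- x) mod N = k" using assms zmod_zminus1_eq_if[of x N] by simp
  then show ?case by simp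
next
  case (2 x)
  then have "(- x) mod N = N - k" using assms zmod_zminus1_eq_if[of x N] by auto
  then show ?case by simp
qed

lemma th_scale:
  assumes "r > 0"
  shows "th one (r\<^sup>2 * c) N k = th one c (r * N) (r * k)"
  unfolding th_def
proof (rule gf_reindex[where j = "\<lambda>m. r * m" and i = "\<lambda>m. m div r"], goal_cases)
  case (1 x)
  then show ?case using assms by (auto simp: power_mult_distrib mult_mod_right)
next
  case (2 y)
  then have y: "y mod (r * N) = r * k" by simp
  then have "r dvd y" by (metis dvd_mod_iff dvd_triv_left)
  then obtain m where "y = r * m" by auto
  then show ?case using y assms by (simp flip: mult_mod_right)
qed

text \<open>Residue classes modulo an even \<open>N\<close> have a definite parity, so the sign is
  constant on each of them.\<close>

lemma th_alt:
  assumes "even N"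
  shows "th alt c N k = (if even k then th one c N k else - th one c N k)"
proof -
  have *: "alt m = (if even k then 1 else -1)" if "m mod N = k" for m
    using that assms by (metis alt_def dvd_mod_iff)
  show ?thesis
    by (rule fps_ext) (auto simp: th_def gf_def * sum_negf)
qed

text \<open>From 2x^2 + 2y^2 = (x + y)^2 + (x - y)^2. By \<open>mult\<close> the whole weight moves
  to the sum, so the difference carries weight 1; \<open>par\<close> makes the substitution
  invertible and \<open>ne\<close> separates the two classes.\<close>

lemma parallelogram_sum:
  assumes "c > 0" "N > 0"
    and mult: "\<And>x y. v x * v y = v (x + y)"
    and iff: "\<And>x y. x mod N' = i \<and> y mod N' = j \<longleftrightarrow>
      (x + y) mod N = k1 \<and> (x - y) mod N = l1 \<or> (x + y) mod N = k2 \<and> (x - y) mod N = l2"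
    and par: "\<And>x y. x mod N = k1 \<and> y mod N = l1 \<or> x mod N = k2 \<and> y mod N = l2 \<Longrightarrow> even (x + y)"
    and ne: "k1 \<noteq> k2"
  shows "th v (2 * c) N' i * th v (2 * c) N' j =
    th v c N k1 * th one c N l1 + th v c N k2 * th one c N l2"
proof -
  let ?U = "{m. m mod N = k1} \<times> {m. m mod N = l1}"
  let ?V = "{m. m mod N = k2} \<times> {m. m mod N = l2}"
  have "th v (2 * c) N' i * th v (2 * c) N' j =
      gf (?U \<union> ?V) (\<lambda>(x, y). c * x\<^sup>2 + c * y\<^sup>2) (\<lambda>(x, y). v x * 1)"
    unfolding th_mult[OF mult_pos_pos[OF zero_less_numeral assms(1)] mult_pos_pos[OF zero_less_numeral assms(1)]]
  proof (rule gf_reindex[where j = "\<lambda>(x, y). (x + y, x - y)"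
        and i = "\<lambda>(x, y). ((x + y) div 2, (x - y) div 2)"], goal_cases)
    case (1 p)
    then show ?case using iff
      by (auto simp: power2_eq_square algebra_simps mult)
  next
    case (2 p)
    obtain x y where p: "p = (x, y)" by force
    have "even (x + y)" using 2 par p by auto
    then obtain a where a: "x + y = 2 * a" by (rule evenE)
    then have "x - y = 2 * (a - y)" by simp
    then have b: "(x - y) div 2 = a - y" by (simp only:) simp
    have x: "x = a + (a - y)" using a by simp
    have "a mod N' = i \<and> (a - y) mod N' = j"
      using 2 p unfolding iff using a x by auto
    then show ?case using p a b by auto
  qed
  also have "\<dots> = gf ?U (\<lambda>(x, y). c * x\<^sup>2 + c * y\<^sup>2) (\<lambda>(x, y). v x * 1) +
      gf ?V (\<lambda>(x, y). c * x\<^sup>2 + c * y\<^sup>2) (\<lambda>(x, y). v x * 1)"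
    by (rule gf_Un) (use assms in \<open>auto intro: proper_square2\<close>)
  finally show ?thesis using assms by (simp add: th_mult)
qed

text \<open>The same substitution read backwards: x^2 + y^2 = 2X^2 + 2Y^2 with x = X + Y, y = X - Y,
  available when x and y have equal parity.\<close>

lemma parallelogram_half:
  assumes "c > 0" "N > 0"
    and iff: "\<And>x y. (x + y) mod N' = i \<and> (x - y) mod N' = j \<longleftrightarrow>
      x mod N = k1 \<and> y mod N = l1 \<or> x mod N = k2 \<and> y mod N = l2"
    and par: "\<And>x y. x mod N' = i \<and> y mod N' = j \<Longrightarrow> even (x + y)"
    and ne: "k1 \<noteq> k2"
  shows "th one c N' i * th one c N' j =
    th one (2 * c) N k1 * th one (2 * c) N l1 + th one (2 * c) N k2 * th one (2 * c) N l2"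
proof -
  let ?U = "{m. m mod N = k1} \<times> {m. m mod N = l1}"
  let ?V = "{m. m mod N = k2} \<times> {m. m mod N = l2}"
  have "gf (?U \<union> ?V) (\<lambda>(x, y). (2 * c) * x\<^sup>2 + (2 * c) * y\<^sup>2) (\<lambda>(x, y). 1 * 1) =
      th one c N' i * th one c N' j"
    unfolding th_mult[OF assms(1) assms(1)]
  proof (rule gf_reindex[where j = "\<lambda>(x, y). (x + y, x - y)"
        and i = "\<lambda>(x, y). ((x + y) div 2, (x - y) div 2)"], goal_cases)
    case (1 p)
    then show ?case using iff
      by (auto simp: power2_eq_square algebra_simps)
  next
    case (2 p)
    obtain x y where p: "p = (x, y)" by force
    have "even (x + y)" using 2 par p by auto
    then obtain a where a: "x + y = 2 * a" by (rule evenE)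
    then have "x - y = 2 * (a - y)" by simp
    then have b: "(x - y) div 2 = a - y" by (simp only:) simp
    have x: "x = a + (a - y)" "y = a - (a - y)" using a by auto
    have "(a + (a - y)) mod N' = i \<and> (a - (a - y)) mod N' = j"
      using 2 p x by auto
    then have "(a, a - y) \<in> ?U \<union> ?V" unfolding iff by auto
    then show ?case using p a b by auto
  qed
  moreover have "gf (?U \<union> ?V) (\<lambda>(x, y). (2 * c) * x\<^sup>2 + (2 * c) * y\<^sup>2) (\<lambda>(x, y). 1 * 1) =
      gf ?U (\<lambda>(x, y). (2 * c) * x\<^sup>2 + (2 * c) * y\<^sup>2) (\<lambda>(x, y). 1 * 1) +
      gf ?V (\<lambda>(x, y). (2 * c) * x\<^sup>2 + (2 * c) * y\<^sup>2) (\<lambda>(x, y). 1 * 1)"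
    by (rule gf_Un) (use assms in \<open>auto intro: proper_square2\<close>)
  ultimately show ?thesis using assms by (simp add: th_mult)
qed

text \<open>(2 + i)(u + iv) = (2u - v) + i(u + 2v) multiplies norms by 5, and x + iy is such a
  product if and only if 5 divides 2x + y. \<open>J\<close> lists residues of the imaginary part,
  \<open>\<kappa> j\<close> is the matching one of the real part.\<close>

lemma gaussian_mult_2i:
  assumes "c > 0" "finite J"
    and iff: "\<And>u v. u mod N' = k \<and> v mod N' = k \<longleftrightarrow>
      (\<exists>j\<in>J. (2 * u - v) mod N = \<kappa> j \<and> (u + 2 * v) mod N = j)"
    and div: "\<And>x y j. j \<in> J \<Longrightarrow> x mod N = \<kappa> j \<Longrightarrow> y mod N = j \<Longrightarrow> 5 dvd 2 * x + y"
  shows "th one (5 * c) N' k * th one (5 * c) N' k = (\<Sum>j\<in>J. th one c N (\<kappa> j) * th one c N j)"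
proof -
  let ?U = "\<lambda>j. {m. m mod N = \<kappa> j} \<times> {m. m mod N = j}"
  have c: "5 * c > 0" using assms by simp
  have "th one (5 * c) N' k * th one (5 * c) N' k =
      gf (\<Union>j\<in>J. ?U j) (\<lambda>(x, y). c * x\<^sup>2 + c * y\<^sup>2) (\<lambda>(x, y). 1 * 1)"
    unfolding th_mult[OF c c]
  proof (rule gf_reindex[where j = "\<lambda>(x, y). (2 * x - y, x + 2 * y)"
        and i = "\<lambda>(x, y). ((2 * x + y) div 5, (2 * y - x) div 5)"], goal_cases)
    case (1 p)
    then show ?case using iff
      by (auto simp: power2_eq_square algebra_simps)
  next
    case (2 p)
    obtain x y where p: "p = (x, y)" by force
    have "5 dvd 2 * x + y" using 2 div p by auto
    then obtain a where a: "2 * x + y = 5 * a" by auto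
    \<comment> \<open>This is (2y - x)/5, written so that no second divisibility has to be
      checked.\<close>
    define b where "b = 2 * a - x"
    have xy: "x = 2 * a - b" "y = a + 2 * b" using a by (auto simp: b_def)
    have "a mod N' = k \<and> b mod N' = k"
      using 2 p unfolding iff xy by auto
    then show ?case using p xy by simp
  qed
  also have "\<dots> = (\<Sum>j\<in>J. gf (?U j) (\<lambda>(x, y). c * x\<^sup>2 + c * y\<^sup>2) (\<lambda>(x, y). 1 * 1))"
    by (rule gf_UN) (use assms in \<open>auto intro: proper_square2\<close>)
  finally show ?thesis using assms by (simp add: th_mult)
qed

subsection \<open>Elimination\<close>

text \<open>
  Only the squares of \<open>X\<close>, \<open>p\<close>, \<open>a\<close>, \<open>d\<close> are known as polynomials in the other series, so all
  conclusions are equalities of squares; the signs need information on the lowest coefficients.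
\<close>

locale theta_relations =
  fixes X p a d m n M N S T W t1 t2 t3 t4 :: "'a::idom"
  assumes X2: "X\<^sup>2 = a\<^sup>2 + 4 * S" and p2: "p\<^sup>2 = d\<^sup>2 + 4 * T"
    and mn: "X\<^sup>2 = m\<^sup>2 + n\<^sup>2" "p\<^sup>2 = 2 * m * n" "a\<^sup>2 = M\<^sup>2 + N\<^sup>2" "d\<^sup>2 = 2 * M * N"
    and S: "S = t1 * t3 + t2 * t4" and T: "T = t1 * t2 + t3 * t4" and W: "W = t1 * t3 - t2 * t4"
    and S2: "S\<^sup>2 = (M * t2 + t3 * N) * (M * t4 + t1 * N)"
    and W2: "W\<^sup>2 = (M * t2 - t3 * N) * (M * t4 - t1 * N)"
    and T2: "T\<^sup>2 = (M * t1 + t4 * N) * (M * t3 + t2 * N)"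
    and two: "(2::'a) \<noteq> 0"
    and nz: "S \<noteq> 0" "W \<noteq> 0" "T \<noteq> 0" "T \<noteq> d\<^sup>2" "d \<noteq> 0"
    and sgn: "m\<^sup>2 - n\<^sup>2 \<noteq> - (M\<^sup>2 - N\<^sup>2 - 4 * W)"
begin

text \<open>Expanded, \<open>S2\<close>, \<open>T2\<close> and \<open>W2\<close> are combinations of
  M^2, MN and N^2 with coefficients t1 t3, t2 t4 and plus or minus \<open>T\<close>. Their sums and
  differences therefore contain \<open>t1\<close> to \<open>t4\<close> only through
  \<open>S\<close>, \<open>T\<close>, \<open>W\<close>, here and in the next two lemmas.\<close>

lemma a2_S: "a\<^sup>2 * S = T\<^sup>2 + W\<^sup>2"
  using mn(3) S T2 W2 by algebra

lemma y_W: "(M\<^sup>2 - N\<^sup>2) * W = T\<^sup>2 - S\<^sup>2"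
  using W T2 S2 by algebra

lemma S2_W2: "S\<^sup>2 = W\<^sup>2 + d\<^sup>2 * T"
  using mn(4) T S2 W2 by algebra

text \<open>(M^2 + N^2)^2 - (M^2 - N^2)^2 = 4M^2N^2 = d^4 eliminates \<open>M\<close> and
  \<open>N\<close>.\<close>

lemma key: "S\<^sup>2 * W\<^sup>2 * p\<^sup>2 = d\<^sup>2 * T ^ 3 * (T - d\<^sup>2)"
proof -
  have "(a\<^sup>2 * S)\<^sup>2 * W\<^sup>2 - ((M\<^sup>2 - N\<^sup>2) * W)\<^sup>2 * S\<^sup>2 = d ^ 4 * S\<^sup>2 * W\<^sup>2"
    using mn(3,4) by algebra
  then have "(T\<^sup>2 + W\<^sup>2)\<^sup>2 * W\<^sup>2 - (T\<^sup>2 - (W\<^sup>2 + d\<^sup>2 * T))\<^sup>2 * (W\<^sup>2 + d\<^sup>2 * T) = d ^ 4 * (W\<^sup>2 + d\<^sup>2 * T) * W\<^sup>2"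
    by (simp only: a2_S y_W S2_W2)
  \<comment> \<open>The resulting relation between \<open>d\<close>, \<open>T\<close>,
    \<open>W\<close> has the factor T - d^2, which cancels; d^2 + 4T is p^2.\<close>
  then have "(T - d\<^sup>2) * (d\<^sup>2 * T ^ 3 * (T - d\<^sup>2) - (W\<^sup>2 + d\<^sup>2 * T) * W\<^sup>2 * (d\<^sup>2 + 4 * T)) = 0"
    by algebra
  then show ?thesis using nz S2_W2 p2 by simp
qed

text \<open>X^4 - p^4 equals both (m^2 - n^2)^2 and (M^2 - N^2 - 4W)^2, and \<open>sgn\<close>
  selects the root. Then the squares and products of \<open>m\<close>, \<open>n\<close> and of
  \<open>M\<close>, \<open>N\<close> are all known, and the left side expands into them.\<close>

lemma D2: "(n * M - m * N)\<^sup>2 = 4 * T * (T - d\<^sup>2)"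
proof -
  have "(m\<^sup>2 - n\<^sup>2)\<^sup>2 = (a\<^sup>2 + 4 * S)\<^sup>2 - (d\<^sup>2 + 4 * T)\<^sup>2"
    using X2 p2 mn by algebra
  also have "\<dots> = (M\<^sup>2 - N\<^sup>2 - 4 * W)\<^sup>2"
    using mn(3,4) a2_S y_W S2_W2 by algebra
  finally have "m\<^sup>2 - n\<^sup>2 = M\<^sup>2 - N\<^sup>2 - 4 * W"
    using sgn by (simp add: power2_eq_iff)
  then have "2 * (n * M - m * N)\<^sup>2 = 2 * (4 * T * (T - d\<^sup>2))"
    using X2 p2 mn a2_S y_W S2_W2 by algebra
  then show ?thesis using two mult_left_cancel by blast
qed

lemma ratio_square: "(p * S\<^sup>2 * a)\<^sup>2 = (d * X * T\<^sup>2)\<^sup>2"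
proof -
  \<comment> \<open>The extra factor \<open>S\<close> makes a^2 S available, which
    \<open>a2_S\<close> evaluates.\<close>
  have "S * (S\<^sup>2 * a\<^sup>2 * (T * (T - d\<^sup>2))) = S * (X\<^sup>2 * T\<^sup>2 * W\<^sup>2)"
    using X2 p2 a2_S S2_W2 key by algebra
  then have *: "S\<^sup>2 * a\<^sup>2 * (T * (T - d\<^sup>2)) = X\<^sup>2 * T\<^sup>2 * W\<^sup>2"
    using nz by simp
  have "W\<^sup>2 * (p * S\<^sup>2 * a)\<^sup>2 = W\<^sup>2 * (d * X * T\<^sup>2)\<^sup>2"
    using * key by algebra
  then show ?thesis using nz by simp
qed

text \<open>Brahmagupta's identity for (m^2 + n^2)(M^2 + N^2) turns \<open>D2\<close> into the value
  of (mM + nN)^2.\<close>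

lemma first_square:
  assumes "p * S\<^sup>2 * a = d * X * T\<^sup>2"
  shows "(2 * p * S - d * X * a)\<^sup>2 = (d * (m * M + n * N))\<^sup>2"
proof -
  have "(n * M - m * N)\<^sup>2 + (m * M + n * N)\<^sup>2 = X\<^sup>2 * a\<^sup>2"
    using mn by algebra
  then have "T\<^sup>2 * (2 * p * S - d * X * a)\<^sup>2 = T\<^sup>2 * (d * (m * M + n * N))\<^sup>2"
    using assms key D2 a2_S by algebra
  then show ?thesis using nz by simp
qed

text \<open>(nM + mN)^2 and (nM - mN)^2 differ by 4mnMN = p^2 d^2, so \<open>D2\<close> gives this
  square too.\<close>

lemma second_square:
  assumes "p * S\<^sup>2 * a = d * X * T\<^sup>2"
  shows "(2 * X * T - a * p * d)\<^sup>2 = (a * (n * M + m * N))\<^sup>2"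
proof -
  have "(n * M + m * N)\<^sup>2 = (n * M - m * N)\<^sup>2 + p\<^sup>2 * d\<^sup>2"
    using mn by algebra
  then have "d\<^sup>2 * T\<^sup>2 * (2 * X * T - a * p * d)\<^sup>2 = d\<^sup>2 * T\<^sup>2 * (a * (n * M + m * N))\<^sup>2"
    using assms key D2 S2_W2 by algebra
  then show ?thesis using nz by simp
qed

end

subsection \<open>Relations between the theta constants\<close>

lemma alt_mult: "alt x * alt y = alt (x + y)"
  by (auto simp: alt_def)

text \<open>X + Y and X - Y have equal parity, so if both are multiples of 5 they are both 0 or both
  5 modulo 10. Applied to x - i, y - j, this splits a pair of classes modulo 5 into two pairs modulo
  10.\<close>

lemma dvd5_pair:
  "(5::int) dvd X \<and> 5 dvd Y \<longleftrightarrow>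
    10 dvd X + Y \<and> 10 dvd X - Y \<or> 10 dvd X + Y - 5 \<and> 10 dvd X - Y - 5"
proof
  assume "5 dvd X \<and> 5 dvd Y"
  then obtain a b where ab: "X = 5 * a" "Y = 5 * b" unfolding dvd_def by blast
  consider c where "a + b = 2 * c" | c where "a + b = 2 * c + 1"
    by (meson evenE oddE)
  then show "10 dvd X + Y \<and> 10 dvd X - Y \<or> 10 dvd X + Y - 5 \<and> 10 dvd X - Y - 5"
  proof cases
    case 1
    then have "X + Y = 10 * c" "X - Y = 10 * (c - b)" using ab by auto
    then show ?thesis by (metis dvd_triv_left)
  next
    case 2
    then have "X + Y - 5 = 10 * c" "X - Y - 5 = 10 * (c - b)" using ab by auto
    then show ?thesis by (metis dvd_triv_left)
  qed
next
  assume "10 dvd X + Y \<and> 10 dvd X - Y \<or> 10 dvd X + Y - 5 \<and> 10 dvd X - Y - 5"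
  then have "\<exists>a b. X + Y = 5 * a \<and> X - Y = 5 * b"
  proof (elim disjE conjE dvdE)
    fix a b
    assume "X + Y = 10 * a" "X - Y = 10 * b"
    then have "X + Y = 5 * (2 * a) \<and> X - Y = 5 * (2 * b)" by simp
    then show ?thesis by blast
  next
    fix a b
    assume "X + Y - 5 = 10 * a" "X - Y - 5 = 10 * b"
    then have "X + Y = 5 * (2 * a + 1) \<and> X - Y = 5 * (2 * b + 1)" by simp
    then show ?thesis by blast
  qed
  then obtain a b where "X + Y = 5 * a" "X - Y = 5 * b" by blast
  \<comment> \<open>From 2X = 5(a + b) and X = 3 * 2X - 5X, which avoids halving; likewise for
    Y.\<close>
  then have "X = 5 * (3 * (a + b) - X)" "Y = 5 * (3 * (a - b) - Y)" by simp_all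
  then show "5 dvd X \<and> 5 dvd Y" by (metis dvd_triv_left)
qed

text \<open>2X and 2Y are multiples of 10, so X and Y are multiples of 5, of equal parity because X
  + Y is even.\<close>

lemma dvd10_pair:
  "(10::int) dvd X + Y \<and> 10 dvd X - Y \<longleftrightarrow> 10 dvd X \<and> 10 dvd Y \<or> 10 dvd X - 5 \<and> 10 dvd Y - 5"
proof
  assume "10 dvd X + Y \<and> 10 dvd X - Y"
  then obtain a b where "X + Y = 10 * a" "X - Y = 10 * b" unfolding dvd_def by blast
  then have ab: "X = 5 * (a + b)" "Y = 5 * (a - b)" by auto
  consider c where "a + b = 2 * c" | c where "a + b = 2 * c + 1"
    by (meson evenE oddE)
  then show "10 dvd X \<and> 10 dvd Y \<or> 10 dvd X - 5 \<and> 10 dvd Y - 5"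
  proof cases
    case 1
    then have "X = 10 * c" "Y = 10 * (c - b)" using ab by auto
    then show ?thesis by (metis dvd_triv_left)
  next
    case 2
    then have "X - 5 = 10 * c" "Y - 5 = 10 * (c - b)" using ab by auto
    then show ?thesis by (metis dvd_triv_left)
  qed
next
  assume "10 dvd X \<and> 10 dvd Y \<or> 10 dvd X - 5 \<and> 10 dvd Y - 5"
  then show "10 dvd X + Y \<and> 10 dvd X - Y"
  proof
    assume "10 dvd X - 5 \<and> 10 dvd Y - 5"
    then have "10 dvd (X - 5) + (Y - 5) + 10" "10 dvd (X - 5) - (Y - 5)"
      by (simp_all only: dvd_add dvd_diff dvd_refl)
    then show ?thesis by simp
  qed simp
qed

lemma even_if_10_dvd: "10 dvd z \<Longrightarrow> even (z::int)"
  by (rule dvd_trans[of 2 10]) simp_all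

lemma one_mult: "one x * one y = one (x + y)"
  by simp

lemma th_mult_mod_5:
  assumes mult: "\<And>x y. v x * v y = v (x + y)"
    and ij: "i \<in> {0..<5}" "j \<in> {0..<5}"
  shows "th v 4 5 i * th v 4 5 j =
    th v 2 10 ((i + j) mod 10) * th one 2 10 ((i - j) mod 10) +
    th v 2 10 ((i + j + 5) mod 10) * th one 2 10 ((i - j + 5) mod 10)"
proof -
  have iff: "x mod 5 = i \<and> y mod 5 = j \<longleftrightarrow>
      (x + y) mod 10 = (i + j) mod 10 \<and> (x - y) mod 10 = (i - j) mod 10 \<or>
      (x + y) mod 10 = (i + j + 5) mod 10 \<and> (x - y) mod 10 = (i - j + 5) mod 10" for x y
  proof -
    define X Y where "X = x - i" and "Y = y - j"
    note dvd5_pair[of X Y]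
    moreover have "x mod 5 = i \<longleftrightarrow> 5 dvd X" "y mod 5 = j \<longleftrightarrow> 5 dvd Y"
      using ij mod_eq_dvd_iff[of x 5 i] mod_eq_dvd_iff[of y 5 j] by (auto simp: X_def Y_def)
    ultimately show ?thesis
      unfolding mod_eq_dvd_iff X_def Y_def by (simp add: algebra_simps)
  qed
  have par: "even (x + y)" if "x mod 10 = (i + j) mod 10 \<and> y mod 10 = (i - j) mod 10 \<or>
      x mod 10 = (i + j + 5) mod 10 \<and> y mod 10 = (i - j + 5) mod 10" for x y
  proof -
    have "even (x - (i + j)) \<and> even (y - (i - j)) \<or> even (x - (i + j + 5)) \<and> even (y - (i - j + 5))"
      using that unfolding mod_eq_dvd_iff by (blast intro: even_if_10_dvd)
    then show ?thesis by auto
  qed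
  have "(i + j) mod 10 \<noteq> (i + j + 5) mod 10"
    unfolding mod_eq_dvd_iff by simp
  from parallelogram_sum[of 2 10 v 5 i j, OF _ _ mult iff par this] show ?thesis
    by simp
qed

text \<open>For q = x^20 these are the series of q^(m^2/10) over the classes modulo 10;
  \<open>t_reflect\<close> folds them onto the six with 0 \<le> k \<le> 5.\<close>

abbreviation t :: "int \<Rightarrow> int fps" where "t \<equiv> th one 2 10"

lemma t_reflect: "t 9 = t 1" "t 8 = t 2" "t 7 = t 3" "t 6 = t 4"
  using th_uminus[of 10 1 2] th_uminus[of 10 2 2] th_uminus[of 10 3 2] th_uminus[of 10 4 2] by simp_all

lemma th4_1_square: "(th one 4 5 1)\<^sup>2 = t 0 * t 2 + t 3 * t 5"
  using th_mult_mod_5[OF one_mult, of 1 1] by (simp add: power2_eq_square t_reflect th_alt algebra_simps)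

lemma th4_2_square: "(th one 4 5 2)\<^sup>2 = t 0 * t 4 + t 1 * t 5"
  using th_mult_mod_5[OF one_mult, of 2 2] by (simp add: power2_eq_square t_reflect th_alt algebra_simps)

lemma th4_1_times_2: "th one 4 5 1 * th one 4 5 2 = t 1 * t 3 + t 2 * t 4"
  using th_mult_mod_5[OF one_mult, of 1 2] by (simp add: power2_eq_square t_reflect th_alt algebra_simps)

lemma th4_0_square: "(th one 4 5 0)\<^sup>2 = (t 0)\<^sup>2 + (t 5)\<^sup>2"
  using th_mult_mod_5[OF one_mult, of 0 0] by (simp add: power2_eq_square t_reflect th_alt algebra_simps)

lemma th_alt_1_square: "(th alt 4 5 1)\<^sup>2 = t 0 * t 2 - t 3 * t 5"
  using th_mult_mod_5[OF alt_mult, of 1 1] by (simp add: power2_eq_square t_reflect th_alt algebra_simps)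

lemma th_alt_2_square: "(th alt 4 5 2)\<^sup>2 = t 0 * t 4 - t 1 * t 5"
  using th_mult_mod_5[OF alt_mult, of 2 2] by (simp add: power2_eq_square t_reflect th_alt algebra_simps)

text \<open>The sign weight negates the term \<open>t 1 * t 3\<close> of the unsigned product. So
  the difference is, up to sign, itself a product of theta series, which makes its square
  computable.\<close>

lemma th_alt_1_times_2: "th alt 4 5 1 * th alt 4 5 2 = - (t 1 * t 3 - t 2 * t 4)"
  using th_mult_mod_5[OF alt_mult, of 1 2] by (simp add: power2_eq_square t_reflect th_alt algebra_simps)

lemma th_mult_mod_10:
  assumes "odd (u + w)"
  shows "th one 1 10 ((u + w) mod 10) * th one 1 10 ((u - w) mod 10) =
    t (u mod 10) * t (w mod 10) + t ((u + 5) mod 10) * t ((w + 5) mod 10)"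
proof -
  have iff: "(x + y) mod 10 = (u + w) mod 10 \<and> (x - y) mod 10 = (u - w) mod 10 \<longleftrightarrow>
      x mod 10 = u mod 10 \<and> y mod 10 = w mod 10 \<or>
      x mod 10 = (u + 5) mod 10 \<and> y mod 10 = (w + 5) mod 10" for x y
  proof -
    define X Y where "X = x - u" and "Y = y - w"
    have "10 dvd X + Y \<and> 10 dvd X - Y \<longleftrightarrow> 10 dvd X \<and> 10 dvd Y \<or> 10 dvd X - 5 \<and> 10 dvd Y - 5"
      by (rule dvd10_pair)
    then show ?thesis
      unfolding mod_eq_dvd_iff X_def Y_def by (simp add: algebra_simps)
  qed
  have par: "even (x + y)" if "x mod 10 = (u + w) mod 10 \<and> y mod 10 = (u - w) mod 10" for x y
  proof -
    have "even (x - (u + w)) \<and> even (y - (u - w))"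
      using that unfolding mod_eq_dvd_iff by (blast intro: even_if_10_dvd)
    then show ?thesis using assms by auto
  qed
  have "u mod 10 \<noteq> (u + 5) mod 10"
    unfolding mod_eq_dvd_iff by simp
  from parallelogram_half[of 1 10 10, OF _ _ iff par this] show ?thesis
    by simp
qed

lemma th1_1_square: "(th one 1 10 1)\<^sup>2 = t 0 * t 1 + t 4 * t 5"
  using th_mult_mod_10[of 1 0] by (simp add: power2_eq_square t_reflect algebra_simps)

lemma th1_3_square: "(th one 1 10 3)\<^sup>2 = t 0 * t 3 + t 2 * t 5"
  using th_mult_mod_10[of 3 0] by (simp add: power2_eq_square t_reflect algebra_simps)

lemma th1_1_times_3: "th one 1 10 1 * th one 1 10 3 = t 1 * t 2 + t 3 * t 4"
  \<comment> \<open>These values solve u + w = 1, u - w = 3.\<close>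
  using th_mult_mod_10[of 2 "-1"] by (simp add: power2_eq_square t_reflect algebra_simps)

lemma th1_5_square: "(th one 1 10 5)\<^sup>2 = 2 * t 0 * t 5"
  using th_mult_mod_10[of 5 0] by (simp add: power2_eq_square t_reflect algebra_simps)

section \<open>Duplication formulas and multiplication by 2 + i for phi and psi\<close>

lemma th20_square: "(th one 20 1 0)\<^sup>2 = (th one 10 2 0)\<^sup>2 + (th one 10 2 1)\<^sup>2"
proof -
  have "th one (2 * 10) 1 0 * th one (2 * 10) 1 0 =
      th one 10 2 0 * th one 10 2 0 + th one 10 2 1 * th one 10 2 1"
    by (rule parallelogram_sum) (auto simp: mod2_eq_if split: if_splits)
  then show ?thesis by (simp add: power2_eq_square)
qed

text \<open>Classically psi(q)^2 = phi(q) psi(q^2), taken at q^2; the preceding lemma is phi(q)^2 =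
  phi(q^2)^2 + 4q psi(q^4)^2.\<close>

lemma th5_square: "(th one 5 2 1)\<^sup>2 = 2 * th one 10 2 0 * th one 10 2 1"
proof -
  have "th one 5 2 1 * th one 5 2 1 = th one (2 * 5) 2 0 * th one (2 * 5) 2 1 +
      th one (2 * 5) 2 1 * th one (2 * 5) 2 0"
    by (rule parallelogram_half) (auto simp: mod2_eq_if split: if_splits)
  then show ?thesis by (simp add: power2_eq_square mult.commute)
qed

lemma bex_eq_conv: "(\<exists>j\<in>J. P j \<and> z = j) \<longleftrightarrow> z \<in> J \<and> P z"
  by blast

text \<open>In the image of 2 + i the first coordinate is twice the second modulo 5. The class j = 0
  gives the pure square; the other four products coincide after m is replaced by -m.\<close>

lemma th20_square_gaussian: "(th one 20 1 0)\<^sup>2 = (th one 4 5 0)\<^sup>2 + 4 * (th one 4 5 1 * th one 4 5 2)"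
proof -
  have "th one (5 * 4) 1 0 * th one (5 * 4) 1 0 =
      (\<Sum>j\<in>{0, 1, 2, 3, 4}. th one 4 5 ((2 * j) mod 5) * th one 4 5 j)"
  proof (rule gaussian_mult_2i)
    fix u v :: int
    have "2 * ((u + 2 * v) mod 5) mod 5 = (2 * (u + 2 * v)) mod 5"
      by (rule mod_mult_right_eq)
    also have "\<dots> = (2 * u - v) mod 5"
      unfolding mod_eq_dvd_iff by simp
    finally have "(2 * u - v) mod 5 = 2 * ((u + 2 * v) mod 5) mod 5" ..
    moreover have "(u + 2 * v) mod 5 \<in> {0, 1, 2, 3, 4}"
      using pos_mod_bound[of 5 "u + 2 * v"] pos_mod_sign[of 5 "u + 2 * v"]
      unfolding insert_iff by linarith
    moreover have "u mod 1 = 0" "v mod 1 = 0" by simp_all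
    ultimately show "u mod 1 = 0 \<and> v mod 1 = 0 \<longleftrightarrow>
        (\<exists>j\<in>{0, 1, 2, 3, 4}. (2 * u - v) mod 5 = 2 * j mod 5 \<and> (u + 2 * v) mod 5 = j)"
      by (simp only: bex_eq_conv simp_thms)
  next
    fix x y j :: int
    assume "x mod 5 = 2 * j mod 5" "y mod 5 = j"
    then have "5 dvd x - 2 * j" "5 dvd y - j"
      unfolding mod_eq_dvd_iff[symmetric] by auto
    then have "5 dvd 2 * (x - 2 * j) + (y - j) + 5 * j"
      by (simp only: dvd_add dvd_mult dvd_triv_left)
    then show "5 dvd 2 * x + y" by simp
  qed simp_all
  moreover have "th one 4 5 3 = th one 4 5 2" "th one 4 5 4 = th one 4 5 1"
    using th_uminus[of 5 2 4] th_uminus[of 5 1 4] by simp_all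
  ultimately show ?thesis by (simp add: power2_eq_square mult.commute)
qed

text \<open>Now u and v are odd, hence so are both coordinates of the image, and 2j + 5 is the odd
  lift of 2j modulo 5. The class j = 5 gives the pure square.\<close>

lemma th5_square_gaussian: "(th one 5 2 1)\<^sup>2 = (th one 1 10 5)\<^sup>2 + 4 * (th one 1 10 1 * th one 1 10 3)"
proof -
  have "th one (5 * 1) 2 1 * th one (5 * 1) 2 1 =
      (\<Sum>j\<in>{1, 3, 5, 7, 9}. th one 1 10 ((2 * j + 5) mod 10) * th one 1 10 j)"
  proof (rule gaussian_mult_2i)
    fix u v :: int
    have "(2 * ((u + 2 * v) mod 10) + 5) mod 10 = (2 * (u + 2 * v) + 5) mod 10"
      by (metis mod_add_left_eq mod_mult_right_eq)
    \<comment> \<open>The congruence between the two coordinates expresses that v is odd; the second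
      coordinate being odd expresses that u is odd.\<close>
    then have "(2 * u - v) mod 10 = (2 * ((u + 2 * v) mod 10) + 5) mod 10 \<longleftrightarrow>
        10 dvd 2 * u - v - (2 * (u + 2 * v) + 5)"
      unfolding mod_eq_dvd_iff[symmetric] by (simp only:)
    also have "2 * u - v - (2 * (u + 2 * v) + 5) = - 5 * (v + 1)"
      by simp
    also have "10 dvd - 5 * (v + 1) \<longleftrightarrow> v mod 2 = 1" by presburger
    finally have "(2 * u - v) mod 10 = (2 * ((u + 2 * v) mod 10) + 5) mod 10 \<longleftrightarrow> v mod 2 = 1" .
    moreover have "z mod 10 \<in> {1, 3, 5, 7, 9} \<longleftrightarrow> z mod 2 = 1" for z :: int
      unfolding insert_iff empty_iff by presburger
    then have "(u + 2 * v) mod 10 \<in> {1, 3, 5, 7, 9} \<longleftrightarrow> u mod 2 = 1"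
      by simp
    ultimately show "u mod 2 = 1 \<and> v mod 2 = 1 \<longleftrightarrow> (\<exists>j\<in>{1, 3, 5, 7, 9}.
        (2 * u - v) mod 10 = (2 * j + 5) mod 10 \<and> (u + 2 * v) mod 10 = j)"
      by (simp only: bex_eq_conv)
  next
    fix x y j :: int
    assume "x mod 10 = (2 * j + 5) mod 10" "y mod 10 = j"
    then have "10 dvd x - (2 * j + 5)" "10 dvd y - j"
      unfolding mod_eq_dvd_iff[symmetric] by auto
    then have "5 dvd x - (2 * j + 5)" "5 dvd y - j"
      by (auto intro: dvd_trans[of 5 10])
    then have "5 dvd 2 * (x - (2 * j + 5)) + (y - j) + 5 * (j + 2)"
      by (simp only: dvd_add dvd_mult dvd_triv_left)
    then show "5 dvd 2 * x + y" by simp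
  qed simp_all
  moreover have "th one 1 10 7 = th one 1 10 3" "th one 1 10 9 = th one 1 10 1"
    using th_uminus[of 10 3 1] th_uminus[of 10 1 1] by simp_all
  ultimately show ?thesis by (simp add: power2_eq_square mult.commute)
qed

section \<open>Lowest exponents and the choice of signs\<close>

lemma subdegree_th:
  assumes "c > 0" "N > 0" "0 \<le> k" "2 * k \<le> N"
  shows "th one c N k $ nat (c * k\<^sup>2) > 0" "subdegree (th one c N k) = nat (c * k\<^sup>2)"
proof -
  have k: "k < N" using assms by linarith
  have fin: "finite {x \<in> {m. m mod N = k}. c * x\<^sup>2 = j}" for j
    by (rule proper_finite[OF proper_square]) (use assms in simp)
  have "k \<in> {x \<in> {m. m mod N = k}. c * x\<^sup>2 = int (nat (c * k\<^sup>2))}"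
    using assms k by simp
  then show pos: "th one c N k $ nat (c * k\<^sup>2) > 0"
    unfolding th_def gf_nth_card using fin by (metis card_gt_0_iff empty_iff of_nat_0_less_iff)
  have "th one c N k $ i = 0" if "i < nat (c * k\<^sup>2)" for i
  proof -
    have "{x \<in> {m. m mod N = k}. c * x\<^sup>2 = int i} = {}"
    proof (rule ccontr)
      assume "\<not> ?thesis"
      then obtain x where x: "x mod N = k" "c * x\<^sup>2 = int i" by auto
      \<comment> \<open>Because 2k \<le> N, no member of the class of k is smaller than k in
        absolute value.\<close>
      have "k \<le> \<bar>x\<bar>"
      proof (cases "x \<ge> 0")
        case True
        then show ?thesis using x(1) assms zmod_le_nonneg_dividend[of x N] by simp
      next
        case False
        show ?thesis
        proof (cases "k = 0")
          case False
          then have "(- x) mod N = N - k" using x(1) zmod_zminus1_eq_if[of x N] by auto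
          moreover have "(- x) mod N \<le> - x" by (rule zmod_le_nonneg_dividend) (use \<open>\<not> 0 \<le> x\<close> in simp)
          ultimately show ?thesis using assms by linarith
        qed simp
      qed
      then have "k\<^sup>2 \<le> x\<^sup>2" using assms by (metis abs_le_square_iff abs_of_nonneg)
      then have "c * k\<^sup>2 \<le> c * x\<^sup>2" using assms by simp
      then show False using that x(2) by linarith
    qed
    then show ?thesis unfolding th_def gf_nth_card by (simp only: card.empty of_nat_0)
  qed
  then show "subdegree (th one c N k) = nat (c * k\<^sup>2)"
    using pos by (intro subdegreeI) auto
qed

definition nonneg :: "int fps \<Rightarrow> bool" where "nonneg F \<longleftrightarrow> (\<forall>n. F $ n \<ge> 0)"

lemma nonneg_intros:
  "nonneg (th one c N k)"
  "nonneg F \<Longrightarrow> nonneg G \<Longrightarrow> nonneg (F * G)"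
  "nonneg F \<Longrightarrow> nonneg G \<Longrightarrow> nonneg (F + G)"
  by (auto simp: nonneg_def th_def gf_nth_card fps_mult_nth intro!: sum_nonneg)

lemma nonneg_power2: "nonneg F \<Longrightarrow> nonneg (F\<^sup>2)"
  by (simp add: power2_eq_square nonneg_intros)

text \<open>Equal squares leave only a sign open, and two nonnegative series that are negatives of
  each other vanish.\<close>

lemma nonneg_square_eqD:
  assumes "nonneg F" "nonneg G" "F\<^sup>2 = G\<^sup>2"
  shows "F = G"
proof (rule ccontr)
  assume "F \<noteq> G"
  then have "F = - G" using assms(3) by (simp add: power2_eq_iff)
  then have "F $ i = G $ i" for i using assms(1,2) unfolding nonneg_def
    by (metis add.inverse_neutral fps_neg_nth neg_0_le_iff_le order_antisym)
  with \<open>F \<noteq> G\<close> show False by (simp add: fps_eq_iff)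
qed

text \<open>
  In terms of \<open>q = x\<^bsup>20\<^esup>\<close>, \<open>Phi\<close> is \<open>\<phi>(q)\<close>, \<open>Psi\<close> is \<open>2q\<^bsup>1/4\<^esup>\<psi>(q\<^sup>2)\<close>, and \<open>Phi5\<close>, \<open>Psi5\<close>
  and \<open>Phi2\<close>, \<open>Psi2\<close> are the same functions of \<open>q\<^sup>5\<close> and \<open>q\<^sup>2\<close>. Likewise \<open>t 0\<close> and \<open>t 5\<close> are these
  functions of \<open>q\<^bsup>10\<^esup>\<close>.
\<close>

abbreviation "Phi \<equiv> th one 20 1 0"
abbreviation "Psi \<equiv> th one 5 2 1"
abbreviation "Phi5 \<equiv> th one 4 5 0"
abbreviation "Psi5 \<equiv> th one 1 10 5"
abbreviation "Phi2 \<equiv> th one 10 2 0"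
abbreviation "Psi2 \<equiv> th one 10 2 1"
abbreviation "S1 \<equiv> th one 4 5 1 * th one 4 5 2"
abbreviation "T1 \<equiv> th one 1 10 1 * th one 1 10 3"

lemma subdegrees:
  "subdegree Phi = 0" "subdegree Psi = 5" "subdegree Phi5 = 0" "subdegree Psi5 = 25"
  "subdegree Phi2 = 0" "subdegree Psi2 = 10" "subdegree (t 0) = 0" "subdegree (t 5) = 50"
  "subdegree (th one 4 5 1) = 4" "subdegree (th one 4 5 2) = 16"
  "subdegree (th one 1 10 1) = 1" "subdegree (th one 1 10 3) = 9"
  by (simp_all add: subdegree_th)

lemma th_nonzero:
  assumes "c > 0" "N > 0" "0 \<le> k" "2 * k \<le> N"
  shows "th one c N k \<noteq> 0"
  using subdegree_th(1)[OF assms] by auto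

lemma subdegrees_S_T: "subdegree S1 = 20" "subdegree T1 = 10" "subdegree (T1 - Psi5\<^sup>2) = 10" "T1 \<noteq> Psi5\<^sup>2"
proof -
  show "subdegree S1 = 20" and T: "subdegree T1 = 10"
    by (simp_all add: th_nonzero subdegrees)
  have d: "subdegree (Psi5\<^sup>2) = 50"
    by (simp add: th_nonzero subdegrees power2_eq_square)
  then show "subdegree (T1 - Psi5\<^sup>2) = 10"
    using T by (subst subdegree_diff_eq1) (simp_all add: th_nonzero)
  show "T1 \<noteq> Psi5\<^sup>2"
  proof
    assume "T1 = Psi5\<^sup>2"
    then have "subdegree T1 = subdegree (Psi5\<^sup>2)" by (rule arg_cong)
    then show False unfolding T d by simp
  qed
qed

lemma constant_terms: "Phi $ 0 > 0" "Phi5 $ 0 > 0" "Phi2 $ 0 > 0" "t 0 $ 0 > 0" "Psi2 $ 0 = 0" "t 5 $ 0 = 0"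
proof -
  show "Phi $ 0 > 0" "Phi5 $ 0 > 0" "Phi2 $ 0 > 0" "t 0 $ 0 > 0"
    using subdegree_th(1)[of 20 1 0] subdegree_th(1)[of 4 5 0] subdegree_th(1)[of 10 2 0]
      subdegree_th(1)[of 2 10 0] by simp_all
  show "Psi2 $ 0 = 0" "t 5 $ 0 = 0"
    by (rule nth_less_subdegree_zero, simp add: subdegrees)+
qed

lemma S1_square: "S1\<^sup>2 = (t 0 * t 2 + t 3 * t 5) * (t 0 * t 4 + t 1 * t 5)"
  by (simp add: power_mult_distrib th4_1_square th4_2_square)

lemma T1_square: "T1\<^sup>2 = (t 0 * t 1 + t 4 * t 5) * (t 0 * t 3 + t 2 * t 5)"
  by (simp add: power_mult_distrib th1_1_square th1_3_square)

lemma W1_square: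
  "(t 1 * t 3 - t 2 * t 4)\<^sup>2 = (t 0 * t 2 - t 3 * t 5) * (t 0 * t 4 - t 1 * t 5)"
proof -
  have "(th alt 4 5 1 * th alt 4 5 2)\<^sup>2 = (t 0 * t 2 - t 3 * t 5) * (t 0 * t 4 - t 1 * t 5)"
    by (simp only: power_mult_distrib th_alt_1_square th_alt_2_square)
  then show ?thesis
    by (simp only: th_alt_1_times_2 power2_minus)
qed

text \<open>This is \<open>S2_W2\<close> for the theta series, needed ahead of the interpretation to
  verify two of its conditions.\<close>

lemma S1_square_W1: "S1\<^sup>2 = (t 1 * t 3 - t 2 * t 4)\<^sup>2 + Psi5\<^sup>2 * T1"
  unfolding S1_square W1_square th1_5_square th1_1_times_3 by algebra

interpretation q: theta_relations Phi Psi Phi5 Psi5 Phi2 Psi2 "t 0" "t 5" S1 T1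
  "t 1 * t 3 - t 2 * t 4" "t 1" "t 2" "t 3" "t 4"
proof
  show "t 1 * t 3 - t 2 * t 4 \<noteq> 0"
  proof
    assume "t 1 * t 3 - t 2 * t 4 = 0"
    then have "S1\<^sup>2 = Psi5\<^sup>2 * T1" using S1_square_W1 by simp
    then have "subdegree (S1\<^sup>2) = subdegree (Psi5\<^sup>2 * T1)" by simp
    \<comment> \<open>The lowest exponents are 40 and 60.\<close>
    then show False by (simp add: power2_eq_square th_nonzero subdegrees)
  qed
  show "Phi2\<^sup>2 - Psi2\<^sup>2 \<noteq> - ((t 0)\<^sup>2 - (t 5)\<^sup>2 - 4 * (t 1 * t 3 - t 2 * t 4))"
  proof
    assume *: "Phi2\<^sup>2 - Psi2\<^sup>2 = - ((t 0)\<^sup>2 - (t 5)\<^sup>2 - 4 * (t 1 * t 3 - t 2 * t 4))"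
    \<comment> \<open>The constant terms of \<open>S1\<close>, \<open>T1\<close> and hence of
      \<open>W\<close> vanish, leaving a positive square equal to minus a square.\<close>
    have "S1 $ 0 = 0" "T1 $ 0 = 0"
      by (rule nth_less_subdegree_zero, simp add: subdegrees_S_T)+
    moreover have "(S1 $ 0)\<^sup>2 = ((t 1 * t 3 - t 2 * t 4) $ 0)\<^sup>2 + (Psi5 $ 0)\<^sup>2 * T1 $ 0"
      using arg_cong[OF S1_square_W1, of "\<lambda>F. F $ 0"]
      by (simp only: power2_eq_square fps_add_nth fps_mult_nth_0)
    ultimately have "((t 1 * t 3 - t 2 * t 4) $ 0)\<^sup>2 = 0"
      by (simp only: power2_eq_square mult_zero_right add_0_right)
    then have W: "(t 1 * t 3 - t 2 * t 4) $ 0 = 0" by simp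
    have "(Phi2 $ 0)\<^sup>2 = - (t 0 $ 0)\<^sup>2"
      using arg_cong[OF *, of "\<lambda>F. F $ 0"] W constant_terms by (simp add: power2_eq_square)
    then show False using constant_terms(3,4) zero_less_power[of "Phi2 $ 0" 2] zero_le_power2[of "t 0 $ 0"] by linarith
  qed
  show "S1 \<noteq> 0" "T1 \<noteq> 0" by (simp_all only: mult_eq_0_iff) (simp_all add: th_nonzero)
  show "T1 \<noteq> Psi5\<^sup>2" by (rule subdegrees_S_T)
qed (rule th20_square_gaussian th5_square_gaussian th20_square th5_square th4_0_square
    th1_5_square th4_1_times_2 th1_1_times_3 S1_square T1_square W1_square refl | simp add: th_nonzero)+

text \<open>Nonnegative coefficients on both sides settle the sign in
  \<open>ratio_square\<close>.\<close>

lemma Psi_S_square: "Psi * S1\<^sup>2 * Phi5 = Psi5 * Phi * T1\<^sup>2"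
  by (rule nonneg_square_eqD[OF _ _ q.ratio_square]) (intro nonneg_intros nonneg_power2)+

lemma Psi_S: "2 * Psi * S1 = Psi5 * (Phi * Phi5 + (Phi2 * t 0 + Psi2 * t 5))"
proof -
  let ?B = "Phi2 * t 0 + Psi2 * t 5"
  have "2 * Psi * S1 - Psi5 * Phi * Phi5 = Psi5 * ?B \<or> 2 * Psi * S1 - Psi5 * Phi * Phi5 = - (Psi5 * ?B)"
    using q.first_square[OF Psi_S_square] by (simp add: power2_eq_iff)
  moreover have False if *: "2 * Psi * S1 - Psi5 * Phi * Phi5 = - (Psi5 * ?B)"
  proof -
    \<comment> \<open>With the wrong sign, 2 * Psi * S1 = Psi5 * (Phi * Phi5 - ?B). The lowest
      exponent of the difference is not visible, so the equation is multiplied by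
      \<open>Phi * Phi5 + ?B\<close> and \<open>D2\<close> applied; the two sides then start at 25
      and 45.\<close>
    have "(Psi2 * t 0 - Phi2 * t 5)\<^sup>2 = (Phi * Phi5 - ?B) * (Phi * Phi5 + ?B)"
      using q.mn by algebra
    with * have "2 * (Psi * S1 * (Phi * Phi5 + ?B)) = Psi5 * (Psi2 * t 0 - Phi2 * t 5)\<^sup>2"
      by algebra
    also have "\<dots> = 4 * (Psi5 * (T1 * (T1 - Psi5\<^sup>2)))"
      unfolding q.D2 by simp
    finally have eq: "subdegree (2 * (Psi * S1 * (Phi * Phi5 + ?B))) = subdegree (4 * (Psi5 * (T1 * (T1 - Psi5\<^sup>2))))"
      by (rule arg_cong)
    have "(Phi * Phi5 + ?B) $ 0 > 0"
      using constant_terms by (simp add: add_pos_pos)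
    then have "Phi * Phi5 + ?B \<noteq> 0" "subdegree (Phi * Phi5 + ?B) = 0"
      by (metis fps_zero_nth less_irrefl, metis less_irrefl subdegree_eq_0_iff)
    then have "subdegree (2 * (Psi * S1 * (Phi * Phi5 + ?B))) = 25"
      by (simp add: th_nonzero subdegrees)
    moreover have "subdegree (4 * (Psi5 * (T1 * (T1 - Psi5\<^sup>2)))) = 45"
      using subdegrees_S_T(3,4) by (simp add: th_nonzero subdegrees)
    ultimately show False using eq by simp
  qed
  ultimately have "2 * Psi * S1 - Psi5 * Phi * Phi5 = Psi5 * ?B" by blast
  then show ?thesis by algebra
qed

lemma Phi_T: "2 * Phi * T1 = Phi5 * (Psi * Psi5 + (Psi2 * t 0 + Phi2 * t 5))"
proof -
  let ?C = "Psi2 * t 0 + Phi2 * t 5"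
  have "2 * Phi * T1 - Phi5 * Psi * Psi5 = Phi5 * ?C \<or> 2 * Phi * T1 - Phi5 * Psi * Psi5 = - (Phi5 * ?C)"
    using q.second_square[OF Psi_S_square] by (simp add: power2_eq_iff)
  moreover have False if *: "2 * Phi * T1 - Phi5 * Psi * Psi5 = - (Phi5 * ?C)"
  proof -
    \<comment> \<open>With the wrong sign, the left side has a positive coefficient at 10, the
      lowest exponent of \<open>Phi * T1\<close>, while the right side starts at 30.\<close>
    have "Phi * T1 + Phi * T1 + Phi5 * ?C = Phi5 * Psi * Psi5"
      using * by algebra
    then have "(Phi * T1) $ 10 + (Phi * T1) $ 10 + (Phi5 * ?C) $ 10 = (Phi5 * Psi * Psi5) $ 10"
      by (metis fps_add_nth)
    moreover have "(Phi5 * Psi * Psi5) $ 10 = 0"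
      by (rule nth_less_subdegree_zero) (simp add: th_nonzero subdegrees)
    moreover have "nonneg (Phi5 * ?C)" "nonneg (Phi * T1)"
      by (intro nonneg_intros)+
    moreover have "(Phi * T1) $ 10 \<noteq> 0"
    proof -
      have "subdegree (Phi * T1) = 10" by (simp add: th_nonzero subdegrees)
      moreover have "Phi * T1 \<noteq> 0" by (simp add: th_nonzero)
      ultimately show ?thesis by (metis nth_subdegree_nonzero)
    qed
    ultimately show False unfolding nonneg_def by (smt (verit))
  qed
  ultimately have "2 * Phi * T1 - Phi5 * Psi * Psi5 = Phi5 * ?C" by blast
  then show ?thesis by algebra
qed

subsection \<open>Counting representations\<close>

text \<open>By \<open>ex1\<close> the set splits according to which rotation satisfies
  \<open>P\<close>, and rotation maps the three pieces onto each other.\<close>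

lemma card_cyclic:
  fixes P :: "int \<Rightarrow> int \<Rightarrow> int \<Rightarrow> bool"
  assumes fin: "finite A"
    and cyc: "\<And>x y z. (x, y, z) \<in> A \<Longrightarrow> (y, z, x) \<in> A"
    and ex1: "\<And>x y z. (x, y, z) \<in> A \<Longrightarrow>
      P x y z \<and> \<not> P y z x \<and> \<not> P z x y \<or> \<not> P x y z \<and> P y z x \<and> \<not> P z x y \<or>
      \<not> P x y z \<and> \<not> P y z x \<and> P z x y"
  shows "card A = 3 * card {(x, y, z). (x, y, z) \<in> A \<and> P x y z}"
proof -
  let ?A1 = "{(x, y, z). (x, y, z) \<in> A \<and> P x y z}"
  let ?A2 = "{(x, y, z). (x, y, z) \<in> A \<and> P y z x}"
  let ?A3 = "{(x, y, z). (x, y, z) \<in> A \<and> P z x y}"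
  have A: "A = ?A1 \<union> (?A2 \<union> ?A3)" using ex1 by auto
  have f: "finite ?A1" "finite ?A2" "finite ?A3"
    by (rule finite_subset[OF _ fin]; auto)+
  have "card A = card ?A1 + card (?A2 \<union> ?A3)"
    by (subst A, rule card_Un_disjoint) (use f ex1 in auto)
  also have "card (?A2 \<union> ?A3) = card ?A2 + card ?A3"
    by (rule card_Un_disjoint) (use f ex1 in auto)
  also have "card ?A2 = card ?A1"
    by (rule bij_betw_same_card[OF bij_betw_byWitness
          [where f = "\<lambda>(x, y, z). (y, z, x)" and f' = "\<lambda>(x, y, z). (z, x, y)"]])
       (auto intro: cyc)
  also have "card ?A3 = card ?A1"
    by (rule bij_betw_same_card[OF bij_betw_byWitness
          [where f = "\<lambda>(x, y, z). (z, x, y)" and f' = "\<lambda>(x, y, z). (y, z, x)"]])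
       (auto intro: cyc)
  finally show ?thesis by simp
qed

text \<open>A Gaussian integer of norm 5m is divisible by 2 + i (\<open>?P\<close>) or by 2 - i
  (\<open>?M\<close>), with as many of each kind as there are elements of norm m, and by both
  exactly when 5 divides it. The parameter z treats all m = h z at once.\<close>

lemma card_two_squares_5:
  fixes h :: "int \<Rightarrow> int"
  assumes fin: "finite {(x :: int, y :: int, z). x\<^sup>2 + y\<^sup>2 = h z}"
  shows "finite {(x :: int, y :: int, z). x\<^sup>2 + y\<^sup>2 = 5 * h z}"
    and "card {(x :: int, y :: int, z). x\<^sup>2 + y\<^sup>2 = 5 * h z} +
      card {(x :: int, y :: int, z). 5 * (x\<^sup>2 + y\<^sup>2) = h z} =
      2 * card {(x :: int, y :: int, z). x\<^sup>2 + y\<^sup>2 = h z}"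
proof -
  let ?H = "{(x :: int, y :: int, z). x\<^sup>2 + y\<^sup>2 = h z}"
  let ?U = "{(x :: int, y :: int, z). x\<^sup>2 + y\<^sup>2 = 5 * h z}"
  let ?P = "{(x, y, z). (x, y, z) \<in> ?U \<and> 5 dvd x - 2 * y}"
  let ?M = "{(x, y, z). (x, y, z) \<in> ?U \<and> 5 dvd x + 2 * y}"
  have P: "bij_betw (\<lambda>(u, v, z). (2 * u - v, u + 2 * v, z)) ?H ?P"
  proof -
    have inv: "2 * ((2 * x + y) div 5) - (2 * y - x) div 5 = x"
      "(2 * x + y) div 5 + 2 * ((2 * y - x) div 5) = y"
      "5 * (((2 * x + y) div 5)\<^sup>2 + ((2 * y - x) div 5)\<^sup>2) = x\<^sup>2 + y\<^sup>2"
      if "5 dvd x - 2 * y" for x y :: int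
    proof -
      from that obtain k where "x - 2 * y = 5 * k" by (rule dvdE)
      then have x: "x = 2 * y + 5 * k" by simp
      have "2 * x + y = 5 * (y + 2 * k)" "2 * y - x = 5 * (- k)" unfolding x by simp_all
      then have "(2 * x + y) div 5 = y + 2 * k" "(2 * y - x) div 5 = - k"
        by simp_all
      then show "2 * ((2 * x + y) div 5) - (2 * y - x) div 5 = x"
        "(2 * x + y) div 5 + 2 * ((2 * y - x) div 5) = y"
        "5 * (((2 * x + y) div 5)\<^sup>2 + ((2 * y - x) div 5)\<^sup>2) = x\<^sup>2 + y\<^sup>2"
        by (simp_all add: x power2_eq_square algebra_simps)
    qed
    show ?thesis
    proof (rule bij_betw_byWitness[where f' = "\<lambda>(x, y, z). ((2 * x + y) div 5, (2 * y - x) div 5, z)"];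
        (intro ballI image_subsetI)?)
      fix p assume "p \<in> ?P"
      then obtain x y z where p: "p = (x, y, z)" "x\<^sup>2 + y\<^sup>2 = 5 * h z" "5 dvd x - 2 * y" by auto
      note i = inv[OF p(3)]
      show "(\<lambda>(x, y, z). ((2 * x + y) div 5, (2 * y - x) div 5, z)) p \<in> ?H"
        using i(3) p(1,2) by simp
      show "(\<lambda>(u, v, z). (2 * u - v, u + 2 * v, z))
          ((\<lambda>(x, y, z). ((2 * x + y) div 5, (2 * y - x) div 5, z)) p) = p"
        using i(1,2) p(1) by simp
    next
      fix p assume "p \<in> ?H"
      then obtain u v z where p: "p = (u, v, z)" "u\<^sup>2 + v\<^sup>2 = h z" by auto
      have "2 * (2 * u - v) + (u + 2 * v) = 5 * u" "2 * (u + 2 * v) - (2 * u - v) = 5 * v"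
        by simp_all
      then show "(\<lambda>(x, y, z). ((2 * x + y) div 5, (2 * y - x) div 5, z))
          ((\<lambda>(u, v, z). (2 * u - v, u + 2 * v, z)) p) = p"
        using p(1) by simp
      have "(2 * u - v)\<^sup>2 + (u + 2 * v)\<^sup>2 = 5 * h z"
        unfolding p(2)[symmetric] by (simp add: power2_eq_square algebra_simps)
      then show "(\<lambda>(u, v, z). (2 * u - v, u + 2 * v, z)) p \<in> ?P"
        using p(1) by simp
    qed
  qed
  have M: "bij_betw (\<lambda>(x, y, z). (x, - y, z)) ?P ?M"
    by (rule bij_betw_byWitness[where f' = "\<lambda>(x, y, z). (x, - y, z)"]) auto
  have U: "?U = ?P \<union> ?M"
  proof -
    have "5 dvd x - 2 * y \<or> 5 dvd x + 2 * y" if "x\<^sup>2 + y\<^sup>2 = 5 * h z" for x y z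
    proof -
      have "(x - 2 * y) * (x + 2 * y) = 5 * (h z - y\<^sup>2)"
        using that by algebra
      then have "5 dvd (x - 2 * y) * (x + 2 * y)" by (rule dvdI)
      moreover have "prime (5 :: int)" by simp
      ultimately show ?thesis by (rule prime_dvd_multD[rotated])
    qed
    then show ?thesis by blast
  qed
  have I: "bij_betw (\<lambda>(x, y, z). (5 * x, 5 * y, z)) {(x :: int, y :: int, z). 5 * (x\<^sup>2 + y\<^sup>2) = h z} (?P \<inter> ?M)"
  proof (rule bij_betw_byWitness[where f' = "\<lambda>(x, y, z). (x div 5, y div 5, z)"];
      (intro ballI image_subsetI)?)
    fix p assume "p \<in> ?P \<inter> ?M"
    then obtain x y z where p: "p = (x, y, z)" "x\<^sup>2 + y\<^sup>2 = 5 * h z" "5 dvd x - 2 * y" "5 dvd x + 2 * y"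
      by blast
    from p(3) obtain a where a: "x - 2 * y = 5 * a" by (rule dvdE)
    from p(4) obtain b where b: "x + 2 * y = 5 * b" by (rule dvdE)
    \<comment> \<open>From 2x = 5(a + b) and 4y = 5(b - a), again without division.\<close>
    have "x = 5 * (3 * (a + b) - x)" using a b by algebra
    moreover have "y = 5 * (y - (b - a))" using a b by algebra
    ultimately obtain u v where uv: "x = 5 * u" "y = 5 * v" by blast
    show "(\<lambda>(x, y, z). (x div 5, y div 5, z)) p \<in> {(x, y, z). 5 * (x\<^sup>2 + y\<^sup>2) = h z}"
      using p(2) by (simp add: p(1) uv power_mult_distrib)
    show "(\<lambda>(x, y, z). (5 * x, 5 * y, z)) ((\<lambda>(x, y, z). (x div 5, y div 5, z)) p) = p"
      by (simp add: p(1) uv)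
  next
    fix p assume "p \<in> {(x :: int, y :: int, z). 5 * (x\<^sup>2 + y\<^sup>2) = h z}"
    then obtain x y z where p: "p = (x, y, z)" "5 * (x\<^sup>2 + y\<^sup>2) = h z" by blast
    show "(\<lambda>(x, y, z). (x div 5, y div 5, z)) ((\<lambda>(x, y, z). (5 * x, 5 * y, z)) p) = p"
      by (simp add: p(1))
    have "5 dvd 5 * x - 2 * (5 * y)" "5 dvd 5 * x + 2 * (5 * y)"
      by (simp_all add: dvd_diff dvd_add)
    then show "(\<lambda>(x, y, z). (5 * x, 5 * y, z)) p \<in> ?P \<inter> ?M"
      using p(2) by (simp add: p(1) power_mult_distrib flip: p(2))
  qed
  have fP: "finite ?P" using P fin bij_betw_finite by blast
  have fM: "finite ?M" using M fP bij_betw_finite by blast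
  show "finite ?U" using fP fM U by simp
  have "card ?U + card (?P \<inter> ?M) = card ?P + card ?M"
    using card_Un_Int[OF fP fM] unfolding U[symmetric] by (rule sym)
  also have "card ?M = card ?P" using bij_betw_same_card[OF M] by simp
  also have "card ?P = card ?H" using bij_betw_same_card[OF P] by simp
  finally show "card ?U + card {(x :: int, y :: int, z). 5 * (x\<^sup>2 + y\<^sup>2) = h z} = 2 * card ?H"
    using bij_betw_same_card[OF I] by simp
qed

definition r155 :: "nat \<Rightarrow> nat" where
  "r155 n = card {(x :: int, y :: int, z :: int). x\<^sup>2 + 5 * y\<^sup>2 + 5 * z\<^sup>2 = int n}"

text \<open>Two applications of \<open>card_two_squares_5\<close> give 3s(n) - 2r(n) representations
  of 25n with last coordinate divisible by 5. In s(n) of them all coordinates are; the remaining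
  2s(n) - 2r(n) are a third of the set \<open>?B\<close>.\<close>

lemma s_25: "int (s (25 * n)) = 7 * int (s n) - 6 * int (r155 n)"
proof -
  let ?C = "\<lambda>h. card {(x :: int, y :: int, z :: int). x\<^sup>2 + y\<^sup>2 = h z}"
  let ?h = "\<lambda>z. int n - z\<^sup>2"
  have s: "{(x :: int, y :: int, z :: int). x\<^sup>2 + y\<^sup>2 = ?h z} = {(x, y, z). x\<^sup>2 + y\<^sup>2 + z\<^sup>2 = int n}"
    by auto
  have fin: "finite {(x :: int, y :: int, z :: int). x\<^sup>2 + y\<^sup>2 = ?h z}"
    unfolding s by (rule finite_sum_three_squares_reps)
  have "card {(x :: int, y :: int, z). 5 * (x\<^sup>2 + y\<^sup>2) = ?h z} = r155 n"
    unfolding r155_def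
    by (rule bij_betw_same_card[OF bij_betw_byWitness
          [where f = "\<lambda>(x, y, z). (z, x, y)" and f' = "\<lambda>(z, x, y). (x, y, z)"]])
       (auto simp: algebra_simps)
  then have 1: "?C (\<lambda>z. 5 * ?h z) + r155 n = 2 * s n"
    using card_two_squares_5(2)[of ?h, OF fin] unfolding s s_def by simp
  have "{(x :: int, y :: int, z). 5 * (x\<^sup>2 + y\<^sup>2) = 5 * ?h z} = {(x, y, z). x\<^sup>2 + y\<^sup>2 + z\<^sup>2 = int n}"
    by auto
  then have 2: "?C (\<lambda>z. 5 * (5 * ?h z)) + s n = 2 * ?C (\<lambda>z. 5 * ?h z)"
    using card_two_squares_5(2)[of "\<lambda>z. 5 * ?h z", OF card_two_squares_5(1)[of ?h, OF fin]] by (simp add: s_def)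
  let ?S = "{(x :: int, y :: int, z :: int). x\<^sup>2 + y\<^sup>2 + z\<^sup>2 = int (25 * n)}"
  let ?A = "{(x, y, z). (x, y, z) \<in> ?S \<and> 5 dvd x \<and> 5 dvd y \<and> 5 dvd z}"
  let ?B = "{(x, y, z). (x, y, z) \<in> ?S \<and> \<not> (5 dvd x \<and> 5 dvd y \<and> 5 dvd z)}"
  let ?B' = "{(x, y, z). (x, y, z) \<in> ?B \<and> 5 dvd z}"
  have f: "finite ?A" "finite ?B" "finite ?B'"
    by (rule finite_subset[OF _ finite_sum_three_squares_reps[of "25 * n"]]; auto)+
  have A: "card ?A = s n"
    unfolding s_def
    by (rule bij_betw_same_card[OF bij_betw_byWitness
          [where f' = "\<lambda>(x, y, z). (5 * x, 5 * y, 5 * z)" and f = "\<lambda>(x, y, z). (x div 5, y div 5, z div 5)"]])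
       (auto elim!: dvdE simp: power2_eq_square)
  have "card ?B = 3 * card ?B'"
  proof (rule card_cyclic[OF f(2)])
    fix x y z :: int assume *: "(x, y, z) \<in> ?B"
    then show "(y, z, x) \<in> ?B" by auto
    \<comment> \<open>Squares modulo 5 are 0, 1 and -1, so three of them with sum 0, not all 0,
      include exactly one 0.\<close>
    have sq: "w\<^sup>2 mod 5 \<in> {1, 4} \<and> \<not> 5 dvd w \<or> w\<^sup>2 mod 5 = 0 \<and> 5 dvd w" for w :: int
    proof -
      have "w mod 5 = 0 \<or> w mod 5 = 1 \<or> w mod 5 = 2 \<or> w mod 5 = 3 \<or> w mod 5 = 4"
        using pos_mod_bound[of 5 w] pos_mod_sign[of 5 w] by linarith
      moreover have "w\<^sup>2 mod 5 = (w mod 5)\<^sup>2 mod 5" by (rule power_mod[symmetric])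
      moreover have "5 dvd w \<longleftrightarrow> w mod 5 = 0" by (rule dvd_eq_mod_eq_0)
      ultimately show ?thesis by (elim disjE) simp_all
    qed
    have sum: "(x\<^sup>2 mod 5 + y\<^sup>2 mod 5 + z\<^sup>2 mod 5) mod 5 = 0"
    proof -
      have "x\<^sup>2 + y\<^sup>2 + z\<^sup>2 = 5 * (5 * int n)" using * by simp
      then have "(x\<^sup>2 + y\<^sup>2 + z\<^sup>2) mod 5 = 0" by simp
      then show ?thesis by (metis mod_add_eq mod_add_left_eq)
    qed
    have "\<not> (5 dvd x \<and> 5 dvd y \<and> 5 dvd z)" using * by blast
    then show "5 dvd z \<and> \<not> 5 dvd x \<and> \<not> 5 dvd y \<or> \<not> 5 dvd z \<and> 5 dvd x \<and> \<not> 5 dvd y \<or>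
        \<not> 5 dvd z \<and> \<not> 5 dvd x \<and> 5 dvd y"
      using sum sq[of x] sq[of y] sq[of z] unfolding insert_iff empty_iff
      by (elim disjE conjE FalseE; simp)
  qed
  moreover have "card ?S = card ?A + card ?B"
    by (subst card_Un_disjoint[symmetric]) (use f in \<open>auto intro!: arg_cong[where f = card]\<close>)
  moreover have "?C (\<lambda>z. 5 * (5 * ?h z)) = card (?A \<union> ?B')"
    by (rule bij_betw_same_card[OF bij_betw_byWitness
          [where f = "\<lambda>(x, y, z). (x, y, 5 * z)" and f' = "\<lambda>(x, y, z). (x, y, z div 5)"]])
       (auto elim!: dvdE simp: power2_eq_square)
  moreover have "card (?A \<union> ?B') = card ?A + card ?B'"
    by (rule card_Un_disjoint) (use f in auto)
  ultimately show ?thesis using 1 2 A unfolding s_def[of "25 * n"] by simp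
qed

text \<open>Every index in these classes is a multiple of 5; dividing by it leaves only parity
  conditions.\<close>

lemma scale5: "Psi5 = th one 25 2 1" "Phi5 = th one 100 1 0" "t 0 = th one 50 2 0" "t 5 = th one 50 2 1"
  using th_scale[of 5 1 2 1] th_scale[of 5 4 1 0] th_scale[of 5 2 2 0] th_scale[of 5 2 2 1] by simp_all

section \<open>Parities of solutions and coefficients at 5n\<close>

lemma square_mod_4:
  fixes x :: int
  obtains (even) a where "even x" "x\<^sup>2 = 4 * a" | (odd) a where "odd x" "x\<^sup>2 = 4 * a + 1"
proof (cases "even x")
  case True
  then obtain y where "x = 2 * y" by (rule evenE)
  then show ?thesis using True by (intro even[of "y\<^sup>2"]) (auto simp: power2_eq_square)
next
  case False
  then obtain y where "x = 2 * y + 1" by (rule oddE)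
  then show ?thesis using False by (intro odd[of "y\<^sup>2 + y"]) (auto simp: power2_eq_square algebra_simps)
qed

lemma diagonal_form_mod_4:
  fixes x y z :: int
  shows "(a * x\<^sup>2 + b * y\<^sup>2 + c * z\<^sup>2) mod 4 =
    (a * of_bool (odd x) + b * of_bool (odd y) + c * of_bool (odd z)) mod 4"
proof -
  have *: "\<exists>k. w\<^sup>2 = 4 * k + of_bool (odd w)" for w :: int
    by (cases w rule: square_mod_4) auto
  obtain k l m where
    "x\<^sup>2 = 4 * k + of_bool (odd x)" "y\<^sup>2 = 4 * l + of_bool (odd y)" "z\<^sup>2 = 4 * m + of_bool (odd z)"
    using * by meson
  then have "a * x\<^sup>2 + b * y\<^sup>2 + c * z\<^sup>2 =
      (a * of_bool (odd x) + b * of_bool (odd y) + c * of_bool (odd z)) + 4 * (a * k + b * l + c * m)"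
    by (simp only: algebra_simps)
  then show ?thesis by (simp only: mod_mult_self2)
qed

lemma three_squares_parity:
  fixes x y z :: int
  assumes "x\<^sup>2 + y\<^sup>2 + z\<^sup>2 = n"
  shows "n mod 4 = 1 \<Longrightarrow> odd x \<and> even y \<and> even z \<or> even x \<and> odd y \<and> even z \<or> even x \<and> even y \<and> odd z"
    and "n mod 4 = 2 \<Longrightarrow> even x \<and> odd y \<and> odd z \<or> odd x \<and> even y \<and> odd z \<or> odd x \<and> odd y \<and> even z"
  using assms diagonal_form_mod_4[of 1 x 1 y 1 z]
  by (cases "even x"; cases "even y"; cases "even z"; simp)+

lemma r155_parity:
  fixes x y z :: int
  assumes "x\<^sup>2 + 5 * y\<^sup>2 + 5 * z\<^sup>2 = n"
  shows "n mod 4 = 1 \<Longrightarrow> odd x \<and> even y \<and> even z \<or> even x \<and> odd y \<and> even z \<or> even x \<and> even y \<and> odd z"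
    and "n mod 4 = 2 \<Longrightarrow> even x \<and> odd y \<and> odd z \<or> odd x \<and> even y \<and> odd z \<or> odd x \<and> odd y \<and> even z"
  using assms diagonal_form_mod_4[of 1 x 5 y 5 z]
  by (cases "even x"; cases "even y"; cases "even z"; simp)+

text \<open>Exactly one coordinate is odd, by rotation the last. Halving the even ones and
  multiplying by 5 gives the exponent 20x^2 + 20y^2 + 5z^2.\<close>

lemma s_nth_1:
  assumes "n mod 4 = 1"
  shows "int (s n) = 3 * (Phi * Phi * Psi) $ (5 * n)"
proof -
  let ?S = "{(x :: int, y :: int, z :: int). x\<^sup>2 + y\<^sup>2 + z\<^sup>2 = int n}"
  have n: "int n mod 4 = 1" using assms by presburger
  note par = three_squares_parity(1)[OF _ n]
  have "s n = 3 * card {(x, y, z). (x, y, z) \<in> ?S \<and> odd z}"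
    unfolding s_def
  proof (rule card_cyclic[OF finite_sum_three_squares_reps])
    fix x y z assume "(x, y, z) \<in> ?S"
    then show "odd z \<and> \<not> odd x \<and> \<not> odd y \<or> \<not> odd z \<and> odd x \<and> \<not> odd y \<or>
        \<not> odd z \<and> \<not> odd x \<and> odd y"
      using par[of x y z] by auto
  qed auto
  also have "card {(x, y, z). (x, y, z) \<in> ?S \<and> odd z} = card {(x, y, z). x mod 1 = 0 \<and> y mod 1 = 0 \<and>
      z mod 2 = 1 \<and> 20 * x\<^sup>2 + 20 * y\<^sup>2 + 5 * z\<^sup>2 = int (5 * n)}" (is "card ?L = card ?R")
  proof (rule bij_betw_same_card[OF bij_betw_byWitness
        [where f = "\<lambda>(x, y, z). (x div 2, y div 2, z)" and f' = "\<lambda>(x, y, z). (2 * x, 2 * y, z)"]])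
    have L: "\<exists>a b. x = 2 * a \<and> y = 2 * b" if "(x, y, z) \<in> ?L" for x y z
      using par[of x y z] that by (auto elim!: evenE)
    show "\<forall>p\<in>?L. (\<lambda>(x, y, z). (2 * x, 2 * y, z)) ((\<lambda>(x, y, z). (x div 2, y div 2, z)) p) = p"
      using L by fastforce
    show "(\<lambda>(x, y, z). (x div 2, y div 2, z)) ` ?L \<subseteq> ?R"
      using L by (fastforce simp: power_mult_distrib odd_iff_mod_2_eq_one)
  qed (auto simp: power_mult_distrib odd_iff_mod_2_eq_one)
  finally show ?thesis using th3_nth[of 20 20 5 1 0 1 0 2 1 "5 * n"] by simp
qed

text \<open>Here exactly one coordinate is even, again moved to the last place.\<close>

lemma s_nth_2:
  assumes "n mod 4 = 2"
  shows "int (s n) = 3 * (Psi * Psi * Phi) $ (5 * n)"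
proof -
  let ?S = "{(x :: int, y :: int, z :: int). x\<^sup>2 + y\<^sup>2 + z\<^sup>2 = int n}"
  have n: "int n mod 4 = 2" using assms by presburger
  note par = three_squares_parity(2)[OF _ n]
  have "s n = 3 * card {(x, y, z). (x, y, z) \<in> ?S \<and> even z}"
    unfolding s_def
  proof (rule card_cyclic[OF finite_sum_three_squares_reps])
    fix x y z assume "(x, y, z) \<in> ?S"
    then show "even z \<and> \<not> even x \<and> \<not> even y \<or> \<not> even z \<and> even x \<and> \<not> even y \<or>
        \<not> even z \<and> \<not> even x \<and> even y"
      using par[of x y z] by auto
  qed auto
  also have "card {(x, y, z). (x, y, z) \<in> ?S \<and> even z} = card {(x, y, z). x mod 2 = 1 \<and> y mod 2 = 1 \<and>
      z mod 1 = 0 \<and> 5 * x\<^sup>2 + 5 * y\<^sup>2 + 20 * z\<^sup>2 = int (5 * n)}" (is "card ?L = card ?R")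
  proof (rule bij_betw_same_card[OF bij_betw_byWitness
        [where f = "\<lambda>(x, y, z). (x, y, z div 2)" and f' = "\<lambda>(x, y, z). (x, y, 2 * z)"]])
    have L: "odd x \<and> odd y \<and> (\<exists>b. z = 2 * b)" if "(x, y, z) \<in> ?L" for x y z
      using par[of x y z] that by (auto elim!: evenE)
    show "(\<lambda>(x, y, z). (x, y, z div 2)) ` ?L \<subseteq> ?R"
      using L by (fastforce simp: power_mult_distrib odd_iff_mod_2_eq_one)
  qed (auto simp: power_mult_distrib odd_iff_mod_2_eq_one)
  finally show ?thesis using th3_nth[of 5 5 20 2 1 2 1 1 0 "5 * n"] by simp
qed

lemma finite_155: "finite {(x :: int, y :: int, z :: int). x\<^sup>2 + 5 * y\<^sup>2 + 5 * z\<^sup>2 = int n}"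
  by (rule finite_subset[of _ "{- int n..int n} \<times> {- int n..int n} \<times> {- int n..int n}"])
    (auto dest!: abs_le_of_square_le, (smt (verit) abs_le_of_square_le atLeastAtMost_iff zero_le_power2)+)

text \<open>The form is symmetric only in y and z, so the distinguished coordinate is x or one of
  two interchangeable ones.\<close>

lemma r155_split:
  fixes P :: "int \<Rightarrow> bool"
  assumes "\<And>x y z. x\<^sup>2 + 5 * y\<^sup>2 + 5 * z\<^sup>2 = int n \<Longrightarrow>
    P x \<and> \<not> P y \<and> \<not> P z \<or> \<not> P x \<and> P y \<and> \<not> P z \<or> \<not> P x \<and> \<not> P y \<and> P z"
  shows "r155 n = card {(x, y, z). x\<^sup>2 + 5 * y\<^sup>2 + 5 * z\<^sup>2 = int n \<and> P x} +
    2 * card {(x, y, z). x\<^sup>2 + 5 * y\<^sup>2 + 5 * z\<^sup>2 = int n \<and> P y}"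
proof -
  let ?R = "{(x :: int, y :: int, z :: int). x\<^sup>2 + 5 * y\<^sup>2 + 5 * z\<^sup>2 = int n}"
  let ?A1 = "{(x, y, z). x\<^sup>2 + 5 * y\<^sup>2 + 5 * z\<^sup>2 = int n \<and> P x}"
  let ?A2 = "{(x, y, z). x\<^sup>2 + 5 * y\<^sup>2 + 5 * z\<^sup>2 = int n \<and> P y}"
  let ?A3 = "{(x, y, z). x\<^sup>2 + 5 * y\<^sup>2 + 5 * z\<^sup>2 = int n \<and> P z}"
  have R: "?R = ?A1 \<union> (?A2 \<union> ?A3)" using assms by blast
  have f: "finite ?A1" "finite ?A2" "finite ?A3"
    by (rule finite_subset[OF _ finite_155[of n]]; auto)+
  have "card ?R = card ?A1 + card (?A2 \<union> ?A3)"
    by (subst R, rule card_Un_disjoint) (use f assms in blast)+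
  also have "card (?A2 \<union> ?A3) = card ?A2 + card ?A3"
    by (rule card_Un_disjoint) (use f assms in blast)+
  also have "card ?A3 = card ?A2"
    by (rule bij_betw_same_card[OF bij_betw_byWitness
          [where f = "\<lambda>(x, y, z). (x, z, y)" and f' = "\<lambda>(x, y, z). (x, z, y)"]])
       auto
  finally show ?thesis by (simp add: r155_def)
qed

lemma r155_nth_1:
  assumes "n mod 4 = 1"
  shows "int (r155 n) = (Psi * Phi5 * Phi5 + 2 * (Phi * Psi5 * Phi5)) $ (5 * n)"
proof -
  have n: "int n mod 4 = 1" using assms by presburger
  note par = r155_parity(1)[OF _ n]
  have "r155 n = card {(x, y, z). x\<^sup>2 + 5 * y\<^sup>2 + 5 * z\<^sup>2 = int n \<and> odd x} +
    2 * card {(x, y, z). x\<^sup>2 + 5 * y\<^sup>2 + 5 * z\<^sup>2 = int n \<and> odd y}"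
    by (rule r155_split) (use par in blast)
  also have "card {(x, y, z). x\<^sup>2 + 5 * y\<^sup>2 + 5 * z\<^sup>2 = int n \<and> odd x} =
      card {(x, y, z). x mod 2 = 1 \<and> y mod 1 = 0 \<and>
      z mod 1 = 0 \<and> 5 * x\<^sup>2 + 100 * y\<^sup>2 + 100 * z\<^sup>2 = int (5 * n)}" (is "card ?L = card ?R")
  proof (rule bij_betw_same_card[OF bij_betw_byWitness
        [where f = "\<lambda>(x, y, z). (x, y div 2, z div 2)" and f' = "\<lambda>(x, y, z). (x, 2 * y, 2 * z)"]])
    have L: "(\<exists>b. y = 2 * b) \<and> (\<exists>b. z = 2 * b)" if "(x, y, z) \<in> ?L" for x y z
      using par[of x y z] that by (auto elim!: evenE)
    show "\<forall>p\<in>?L. (\<lambda>(x, y, z). (x, 2 * y, 2 * z)) ((\<lambda>(x, y, z). (x, y div 2, z div 2)) p) = p"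
      using L by fastforce
    show "(\<lambda>(x, y, z). (x, y div 2, z div 2)) ` ?L \<subseteq> ?R"
      using L by (fastforce simp: power_mult_distrib odd_iff_mod_2_eq_one)
  qed (auto simp: power_mult_distrib odd_iff_mod_2_eq_one)
  also have "card {(x, y, z). x\<^sup>2 + 5 * y\<^sup>2 + 5 * z\<^sup>2 = int n \<and> odd y} =
      card {(x, y, z). x mod 1 = 0 \<and> y mod 2 = 1 \<and>
      z mod 1 = 0 \<and> 20 * x\<^sup>2 + 25 * y\<^sup>2 + 100 * z\<^sup>2 = int (5 * n)}" (is "card ?L = card ?R")
  proof (rule bij_betw_same_card[OF bij_betw_byWitness
        [where f = "\<lambda>(x, y, z). (x div 2, y, z div 2)" and f' = "\<lambda>(x, y, z). (2 * x, y, 2 * z)"]])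
    have L: "(\<exists>b. x = 2 * b) \<and> (\<exists>b. z = 2 * b)" if "(x, y, z) \<in> ?L" for x y z
      using par[of x y z] that by (auto elim!: evenE)
    show "\<forall>p\<in>?L. (\<lambda>(x, y, z). (2 * x, y, 2 * z)) ((\<lambda>(x, y, z). (x div 2, y, z div 2)) p) = p"
      using L by fastforce
    show "(\<lambda>(x, y, z). (x div 2, y, z div 2)) ` ?L \<subseteq> ?R"
      using L by (fastforce simp: power_mult_distrib odd_iff_mod_2_eq_one)
  qed (auto simp: power_mult_distrib odd_iff_mod_2_eq_one)
  finally show ?thesis
    using th3_nth[of 5 100 100 2 1 1 0 1 0 "5 * n"] th3_nth[of 20 25 100 1 0 2 1 1 0 "5 * n"]
    unfolding scale5 fps_add_nth mult_2 by simp
qed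

lemma r155_nth_2:
  assumes "n mod 4 = 2"
  shows "int (r155 n) = (Phi * Psi5 * Psi5 + 2 * (Psi * Phi5 * Psi5)) $ (5 * n)"
proof -
  have n: "int n mod 4 = 2" using assms by presburger
  note par = r155_parity(2)[OF _ n]
  have "r155 n = card {(x, y, z). x\<^sup>2 + 5 * y\<^sup>2 + 5 * z\<^sup>2 = int n \<and> even x} +
    2 * card {(x, y, z). x\<^sup>2 + 5 * y\<^sup>2 + 5 * z\<^sup>2 = int n \<and> even y}"
    by (rule r155_split) (use par in blast)
  also have "card {(x, y, z). x\<^sup>2 + 5 * y\<^sup>2 + 5 * z\<^sup>2 = int n \<and> even x} =
      card {(x, y, z). x mod 1 = 0 \<and> y mod 2 = 1 \<and>
      z mod 2 = 1 \<and> 20 * x\<^sup>2 + 25 * y\<^sup>2 + 25 * z\<^sup>2 = int (5 * n)}" (is "card ?L = card ?R")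
  proof (rule bij_betw_same_card[OF bij_betw_byWitness
        [where f = "\<lambda>(x, y, z). (x div 2, y, z)" and f' = "\<lambda>(x, y, z). (2 * x, y, z)"]])
    have L: "(\<exists>b. x = 2 * b) \<and> odd y \<and> odd z" if "(x, y, z) \<in> ?L" for x y z
      using par[of x y z] that by (auto elim!: evenE)
    show "(\<lambda>(x, y, z). (x div 2, y, z)) ` ?L \<subseteq> ?R"
      using L by (fastforce simp: power_mult_distrib odd_iff_mod_2_eq_one)
  qed (auto simp: power_mult_distrib odd_iff_mod_2_eq_one)
  also have "card {(x, y, z). x\<^sup>2 + 5 * y\<^sup>2 + 5 * z\<^sup>2 = int n \<and> even y} =
      card {(x, y, z). x mod 2 = 1 \<and> y mod 1 = 0 \<and>
      z mod 2 = 1 \<and> 5 * x\<^sup>2 + 100 * y\<^sup>2 + 25 * z\<^sup>2 = int (5 * n)}" (is "card ?L = card ?R")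
  proof (rule bij_betw_same_card[OF bij_betw_byWitness
        [where f = "\<lambda>(x, y, z). (x, y div 2, z)" and f' = "\<lambda>(x, y, z). (x, 2 * y, z)"]])
    have L: "odd x \<and> (\<exists>b. y = 2 * b) \<and> odd z" if "(x, y, z) \<in> ?L" for x y z
      using par[of x y z] that by (auto elim!: evenE)
    show "(\<lambda>(x, y, z). (x, y div 2, z)) ` ?L \<subseteq> ?R"
      using L by (fastforce simp: power_mult_distrib odd_iff_mod_2_eq_one)
  qed (auto simp: power_mult_distrib odd_iff_mod_2_eq_one)
  finally show ?thesis
    using th3_nth[of 20 25 25 1 0 2 1 2 1 "5 * n"] th3_nth[of 5 100 25 2 1 1 0 2 1 "5 * n"]
    unfolding scale5 fps_add_nth mult_2 by simp
qed

section \<open>Diagonalisation of (2,2,2,-1,1,1)\<close>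

lemma form_same_parity:
  fixes x y z :: int
  assumes "2 * x\<^sup>2 + 2 * y\<^sup>2 + 2 * z\<^sup>2 - y * z - z * x - x * y = n" "even (x + y)" "even (y + z)"
  shows "n mod 4 = 0 \<or> n mod 4 = 3"
proof -
  have "even (y - x)" "even (z - x)" using assms(2,3) by auto
  then obtain b c where "y - x = 2 * b" "z - x = 2 * c" by (elim evenE)
  then have y: "y = x + 2 * b" and z: "z = x + 2 * c" by simp_all
  \<comment> \<open>After the substitution the form is 3x^2 plus 4 times this.\<close>
  define k where "k = x * b + x * c + 2 * b\<^sup>2 + 2 * c\<^sup>2 - b * c"
  have n: "n = 3 * x\<^sup>2 + 4 * k"
    unfolding assms(1)[symmetric] y z k_def by algebra
  show ?thesis
    by (cases x rule: square_mod_4) (simp_all add: n, presburger+)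
qed

text \<open>This is the symmetrised form at y = u + v, z = u - v. For odd u the product x(x - u) is
  even, so n is congruent to 3 + 5v^2, that is to 3 or 0 modulo 4.\<close>

lemma form_even_sum:
  fixes x u v :: int
  assumes "2 * x\<^sup>2 - 2 * x * u + 3 * u\<^sup>2 + 5 * v\<^sup>2 = n" "n mod 4 = 1 \<or> n mod 4 = 2"
  shows "even u"
proof (rule ccontr)
  assume u: "odd u"
  have "even (x * (x - u))" using u by simp
  then obtain a where a: "x * (x - u) = 2 * a" by (rule evenE)
  \<comment> \<open>The term \<open>0 * x\<^sup>2\<close> fits the sum to the three variables of
    \<open>diagonal_form_mod_4\<close>.\<close>
  have "n = 4 * a + (3 * u\<^sup>2 + 5 * v\<^sup>2 + 0 * x\<^sup>2)"
  proof -
    have "n = 2 * (x * (x - u)) + 3 * u\<^sup>2 + 5 * v\<^sup>2"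
      unfolding assms(1)[symmetric] by algebra
    then show ?thesis unfolding a by simp
  qed
  then have "n mod 4 = (3 * u\<^sup>2 + 5 * v\<^sup>2 + 0 * x\<^sup>2) mod 4"
    by (simp only: mod_mult_self4)
  then show False
    using assms(2) u unfolding diagonal_form_mod_4 by (cases "even v") simp_all
qed

text \<open>Replacing x by -x makes the form symmetric. As x, y, z are not all of one parity,
  exactly one pair has even sum, by rotation y and z. Then 4 divides y + z, and x = w + u, y = 2u +
  v, z = 2u - v completes the square.\<close>

lemma rep_count_eq:
  assumes "n mod 4 = 1 \<or> n mod 4 = 2"
  shows "rep_count 2 2 2 (-1) 1 1 n = 3 * card {(v :: int, w :: int, u :: int). 2 * w\<^sup>2 + 10 * u\<^sup>2 + 5 * v\<^sup>2 = int n}"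
proof -
  have n: "int n mod 4 = 1 \<or> int n mod 4 = 2" using assms by presburger
  let ?F = "\<lambda>x y z :: int. 2 * x\<^sup>2 + 2 * y\<^sup>2 + 2 * z\<^sup>2 - y * z - z * x - x * y"
  let ?Q = "{(x, y, z). ?F x y z = int n}"
  let ?K = "{(v :: int, w :: int, u :: int). 2 * w\<^sup>2 + 10 * u\<^sup>2 + 5 * v\<^sup>2 = int n}"
  have Q: "bij_betw (\<lambda>(x, y, z). (- x, y, z)) {(x :: int, y :: int, z :: int).
      2 * x\<^sup>2 + 2 * y\<^sup>2 + 2 * z\<^sup>2 + (-1) * y * z + 1 * z * x + 1 * x * y = int n} ?Q"
    by (rule bij_betw_byWitness[where f' = "\<lambda>(x, y, z). (- x, y, z)"]) auto
  have "rep_count 2 2 2 (-1) 1 1 n = card ?Q"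
    unfolding rep_count_def by (rule bij_betw_same_card[OF Q])
  also have "\<dots> = 3 * card {(x, y, z). (x, y, z) \<in> ?Q \<and> even (y + z)}"
  proof (rule card_cyclic)
    show "finite ?Q" using bij_betw_finite[OF Q] finite_reps_2_2_2_m1_1_1[of n] by simp
    fix x y z assume *: "(x, y, z) \<in> ?Q"
    then show "(y, z, x) \<in> ?Q" by (simp add: algebra_simps)
    have "\<not> (even (x + y) \<and> even (y + z))"
    proof
      assume "even (x + y) \<and> even (y + z)"
      then have "int n mod 4 = 0 \<or> int n mod 4 = 3"
        using form_same_parity[of x y z "int n"] * by blast
      then show False using n by linarith
    qed
    then show "even (y + z) \<and> \<not> even (z + x) \<and> \<not> even (x + y) \<or>
        \<not> even (y + z) \<and> even (z + x) \<and> \<not> even (x + y) \<or>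
        \<not> even (y + z) \<and> \<not> even (z + x) \<and> even (x + y)"
      by auto
  qed
  also have "card {(x, y, z). (x, y, z) \<in> ?Q \<and> even (y + z)} = card ?K"
  proof (rule bij_betw_same_card[OF bij_betw_byWitness
        [where f = "\<lambda>(x, y, z). ((y - z) div 2, x - (y + z) div 4, (y + z) div 4)"
          and f' = "\<lambda>(v, w, u). (w + u, 2 * u + v, 2 * u - v)"]]; (intro ballI image_subsetI)?)
    fix p assume "p \<in> {(x, y, z). (x, y, z) \<in> ?Q \<and> even (y + z)}"
    then obtain x y z where p: "p = (x, y, z)" "?F x y z = int n" "even (y + z)" by blast
    from p(3) obtain r where r: "y + z = 2 * r" by (rule evenE)
    define v where "v = y - r"
    have yz: "y = r + v" "z = r - v" using r by (simp_all add: v_def)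
    have "2 * x\<^sup>2 - 2 * x * r + 3 * r\<^sup>2 + 5 * v\<^sup>2 = int n"
      unfolding p(2)[symmetric] yz by algebra
    then have "even r" using n by (rule form_even_sum)
    then obtain u where u: "r = 2 * u" by (rule evenE)
    have d: "(y - z) div 2 = v" "(y + z) div 4 = u"
      unfolding yz u by simp_all
    show "(\<lambda>(v, w, u). (w + u, 2 * u + v, 2 * u - v))
        ((\<lambda>(x, y, z). ((y - z) div 2, x - (y + z) div 4, (y + z) div 4)) p) = p"
      using d by (simp add: p(1) yz u)
    have "2 * (x - u)\<^sup>2 + 10 * u\<^sup>2 + 5 * v\<^sup>2 = int n"
      unfolding p(2)[symmetric] yz u by algebra
    then show "(\<lambda>(x, y, z). ((y - z) div 2, x - (y + z) div 4, (y + z) div 4)) p \<in> ?K"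
      using d by (simp add: p(1))
  next
    fix p assume "p \<in> ?K"
    then obtain v w u where p: "p = (v, w, u)" "2 * w\<^sup>2 + 10 * u\<^sup>2 + 5 * v\<^sup>2 = int n" by blast
    show "(\<lambda>(x, y, z). ((y - z) div 2, x - (y + z) div 4, (y + z) div 4))
        ((\<lambda>(v, w, u). (w + u, 2 * u + v, 2 * u - v)) p) = p"
      by (simp add: p(1))
    have "?F (w + u) (2 * u + v) (2 * u - v) = int n"
      unfolding p(2)[symmetric] by algebra
    then show "(\<lambda>(v, w, u). (w + u, 2 * u + v, 2 * u - v)) p \<in> {(x, y, z). (x, y, z) \<in> ?Q \<and> even (y + z)}"
      by (simp add: p(1))
  qed
  finally show ?thesis .
qed

lemma finite_K: "finite {(v :: int, w :: int, u :: int). 2 * w\<^sup>2 + 10 * u\<^sup>2 + 5 * v\<^sup>2 = int n}"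
proof (rule finite_subset)
  show "{(v, w, u). 2 * w\<^sup>2 + 10 * u\<^sup>2 + 5 * v\<^sup>2 = int n} \<subseteq> {- int n..int n} \<times> {- int n..int n} \<times> {- int n..int n}"
  proof clarify
    fix v w u :: int
    assume "2 * w\<^sup>2 + 10 * u\<^sup>2 + 5 * v\<^sup>2 = int n"
    then have "v\<^sup>2 \<le> int n" "w\<^sup>2 \<le> int n" "u\<^sup>2 \<le> int n"
      using zero_le_power2[of v] zero_le_power2[of w] zero_le_power2[of u] by linarith+
    then show "v \<in> {- int n..int n} \<and> (w, u) \<in> {- int n..int n} \<times> {- int n..int n}"
      using abs_le_of_square_le by blast
  qed
qed simp

lemma K_parity:
  fixes v w u :: int
  assumes "2 * w\<^sup>2 + 10 * u\<^sup>2 + 5 * v\<^sup>2 = n"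
  shows "n mod 4 = 1 \<Longrightarrow> odd v \<and> (odd w \<longleftrightarrow> odd u)"
    and "n mod 4 = 2 \<Longrightarrow> even v \<and> (odd w \<longleftrightarrow> even u)"
  using assms diagonal_form_mod_4[of 2 w 10 u 5 v]
  by (cases "even v"; cases "even w"; cases "even u"; simp)+

text \<open>w and u are both even or both odd, whence two products; 5 times the diagonal form is
  25v^2 + 10w^2 + 50u^2.\<close>

lemma rep_nth_1:
  assumes "n mod 4 = 1"
  shows "int (rep_count 2 2 2 (-1) 1 1 n) = 3 * (Psi5 * Phi2 * t 0 + Psi5 * Psi2 * t 5) $ (5 * n)"
proof -
  have n: "int n mod 4 = 1" using assms by presburger
  note par = K_parity(1)[OF _ n]
  let ?K = "{(v :: int, w :: int, u :: int). 2 * w\<^sup>2 + 10 * u\<^sup>2 + 5 * v\<^sup>2 = int n}"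
  let ?A = "\<lambda>i::int. {(v :: int, w :: int, u :: int). v mod 2 = 1 \<and> w mod 2 = i \<and> u mod 2 = i \<and>
    25 * v\<^sup>2 + 10 * w\<^sup>2 + 50 * u\<^sup>2 = int (5 * n)}"
  have K: "?K = ?A 0 \<union> ?A 1"
  proof (intro subset_antisym subsetI)
    fix p assume "p \<in> ?K"
    then obtain v w u where p: "p = (v, w, u)" "2 * w\<^sup>2 + 10 * u\<^sup>2 + 5 * v\<^sup>2 = int n" by blast
    then show "p \<in> ?A 0 \<union> ?A 1"
      using par[OF p(2)] by (cases "even w") (auto simp: odd_iff_mod_2_eq_one even_iff_mod_2_eq_zero)
  qed auto
  have "finite (?A 0 \<union> ?A 1)" unfolding K[symmetric] by (rule finite_K)
  then have "card ?K = card (?A 0) + card (?A 1)"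
    unfolding K by (intro card_Un_disjoint) auto
  then show ?thesis
    using rep_count_eq[of n] assms th3_nth[of 25 10 50 2 1 2 0 2 0 "5 * n"] th3_nth[of 25 10 50 2 1 2 1 2 1 "5 * n"]
    unfolding scale5 fps_add_nth by simp
qed

text \<open>Now v is even and w, u have opposite parity, so \<open>Psi2\<close> meets
  \<open>t 0\<close> and \<open>Phi2\<close> meets \<open>t 5\<close>.\<close>

lemma rep_nth_2:
  assumes "n mod 4 = 2"
  shows "int (rep_count 2 2 2 (-1) 1 1 n) = 3 * (Phi5 * Psi2 * t 0 + Phi5 * Phi2 * t 5) $ (5 * n)"
proof -
  have n: "int n mod 4 = 2" using assms by presburger
  note par = K_parity(2)[OF _ n]
  let ?K = "{(v :: int, w :: int, u :: int). 2 * w\<^sup>2 + 10 * u\<^sup>2 + 5 * v\<^sup>2 = int n}"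
  let ?A = "\<lambda>i j::int. {(v :: int, w :: int, u :: int). v mod 1 = 0 \<and> w mod 2 = i \<and> u mod 2 = j \<and>
    100 * v\<^sup>2 + 10 * w\<^sup>2 + 50 * u\<^sup>2 = int (5 * n)}"
  have K: "bij_betw (\<lambda>(v, w, u). (2 * v, w, u)) (?A 1 0 \<union> ?A 0 1) ?K"
  proof (rule bij_betw_byWitness[where f' = "\<lambda>(v, w, u). (v div 2, w, u)"]; (intro ballI image_subsetI)?)
    fix p assume "p \<in> ?K"
    then obtain v w u where p: "p = (v, w, u)" "2 * w\<^sup>2 + 10 * u\<^sup>2 + 5 * v\<^sup>2 = int n" by blast
    from par[OF p(2)] obtain a where a: "v = 2 * a" by (auto elim: evenE)
    show "(\<lambda>(v, w, u). (2 * v, w, u)) ((\<lambda>(v, w, u). (v div 2, w, u)) p) = p"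
      by (simp add: p(1) a)
    have "100 * a\<^sup>2 + 10 * w\<^sup>2 + 50 * u\<^sup>2 = int (5 * n)"
      using p(2) by (simp add: a power_mult_distrib)
    then show "(\<lambda>(v, w, u). (v div 2, w, u)) p \<in> ?A 1 0 \<union> ?A 0 1"
      using par[OF p(2)] by (auto simp: p(1) a odd_iff_mod_2_eq_one even_iff_mod_2_eq_zero)
  qed (auto simp: power_mult_distrib)
  have "finite (?A 1 0 \<union> ?A 0 1)" using K finite_K[of n] bij_betw_finite by blast
  then have "card (?A 1 0 \<union> ?A 0 1) = card (?A 1 0) + card (?A 0 1)"
    by (intro card_Un_disjoint) auto
  then have "card ?K = card (?A 1 0) + card (?A 0 1)"
    using bij_betw_same_card[OF K] by simp
  then show ?thesis
    using rep_count_eq[of n] assms th3_nth[of 100 10 50 1 0 2 1 2 0 "5 * n"] th3_nth[of 100 10 50 1 0 2 0 2 1 "5 * n"]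
    unfolding scale5 fps_add_nth by simp
qed

theorem theorem1p1:
  fixes n :: nat
  assumes "n mod 4 = 1 \<or> n mod 4 = 2"
  shows "int (s (25 * n)) - 5 * int (s n) = 4 * int (rep_count 2 2 2 (-1) 1 1 n)"
  using assms
proof
  assume n: "n mod 4 = 1"
  \<comment> \<open>Twice \<open>Psi_S\<close> with 4 * S1 replaced by Phi^2 - Phi5^2; at exponent
    5n it reads s(n) = 3r(n) + 2(2,2,2,-1,1,1)(n).\<close>
  have "3 * (Phi * Phi * Psi) =
      3 * (Psi * Phi5 * Phi5 + 2 * (Phi * Psi5 * Phi5)) + 3 * (2 * (Psi5 * Phi2 * t 0 + Psi5 * Psi2 * t 5))"
    using Psi_S th20_square_gaussian by algebra
  then have "3 * (Phi * Phi * Psi) $ (5 * n) = 3 * (Psi * Phi5 * Phi5 + 2 * (Phi * Psi5 * Phi5)) $ (5 * n) +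
      6 * (Psi5 * Phi2 * t 0 + Psi5 * Psi2 * t 5) $ (5 * n)"
    by (auto dest!: arg_cong[where f = "\<lambda>F. F $ (5 * n)"] simp: numeral_fps_const)
  then show ?thesis
    unfolding s_25 s_nth_1[OF n] r155_nth_1[OF n] rep_nth_1[OF n] by linarith
next
  assume n: "n mod 4 = 2"
  \<comment> \<open>Likewise twice \<open>Phi_T\<close> with 4 * T1 replaced by Psi^2 -
    Psi5^2.\<close>
  have "3 * (Psi * Psi * Phi) =
      3 * (Phi * Psi5 * Psi5 + 2 * (Psi * Phi5 * Psi5)) + 3 * (2 * (Phi5 * Psi2 * t 0 + Phi5 * Phi2 * t 5))"
    using Phi_T th5_square_gaussian by algebra
  then have "3 * (Psi * Psi * Phi) $ (5 * n) = 3 * (Phi * Psi5 * Psi5 + 2 * (Psi * Phi5 * Psi5)) $ (5 * n) +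
      6 * (Phi5 * Psi2 * t 0 + Phi5 * Phi2 * t 5) $ (5 * n)"
    by (auto dest!: arg_cong[where f = "\<lambda>F. F $ (5 * n)"] simp: numeral_fps_const)
  then show ?thesis
    unfolding s_25 s_nth_2[OF n] r155_nth_2[OF n] rep_nth_2[OF n] by linarith
qed

end
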